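(* There exists a group $H$ that has property $\mathrm{FGFP_a}$ and whose commutator subgroup $H'$ is finitely generated, but such that $H \times \mathbb{Z}$ does not have property $\mathrm{FGFP_a}$.
   Context: A group $G$ has property $\mathrm{FGFP_a}$ if for every $\phi \in \mathrm{Aut}(G)$ the fixed subgroup $\mathrm{Fix}\,\phi = \{g \in G \mid \phi(g) = g\}$ is finitely generated. *)

theory Defs
  imports "HOL-Algebra.Algebra"
begin

(* Meant for a subgroup H of a group G: "generate G S" is then also the subgroup
   of H generated by S. *)
definition fg_subgroup :: "('a, 'b) monoid_scheme \<Rightarrow> 'a set \<Rightarrow> bool" where
  "fg_subgroup G H \<longleftrightarrow> (\<exists>S. finite S \<and> S \<subseteq> H \<and> generate G S = H)"

(* "iso G G" does not constrain values outside the carrier; these do not affect Fix. *)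
definition Fix :: "('a, 'b) monoid_scheme \<Rightarrow> ('a \<Rightarrow> 'a) \<Rightarrow> 'a set" where
  "Fix G \<phi> = {g \<in> carrier G. \<phi> g = g}"

(* Taking the identity automorphism shows that a group with this property is finitely
   generated, hence countable; so up to isomorphism its carrier is a set of natural numbers,
   and existence over "nat monoid" is existence over all groups. *)
definition FGFPa :: "('a, 'b) monoid_scheme \<Rightarrow> bool" where
  "FGFPa G \<longleftrightarrow> (\<forall>\<phi> \<in> iso G G. fg_subgroup G (Fix G \<phi>))"

end

theory Submission
  imports Defs
begin

text \<open>
The group is \<open>H = F \<wr> C\<^sub>2\<close>, two copies of a free group \<open>F\<close> of
rank two together with an involution \<open>\<sigma>\<close> that swaps them.

The key point is the behaviour of \<open>Fix\<close> under a twist by a homomorphism to the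
integers. If \<open>\<phi>\<close> is an automorphism of \<open>H\<close> and \<open>\<theta> : H
\<rightarrow> \<int>\<close> is \<open>\<phi>\<close>-invariant, then \<open>(h, n) \<mapsto>
(\<phi> h, n + \<theta> h)\<close> is an automorphism of \<open>H \<times> \<int>\<close> that fixes
exactly \<open>(Fix \<phi> \<inter> ker \<theta>) \<times> \<int>\<close>. Take for
\<open>\<phi>\<close> the conjugation by \<open>\<sigma>\<close>, so that \<open>Fix \<phi>\<close>
is the diagonal copy of \<open>F\<close> times \<open>\<langle>\<sigma>\<rangle>\<close>, and for
\<open>\<theta>\<close> the sum of the values of a nontrivial \<open>\<chi> : F \<rightarrow>
\<int>\<close> on the two copies. The intersection is then \<open>ker \<chi>\<close> times
\<open>\<langle>\<sigma>\<rangle>\<close>, and \<open>ker \<chi>\<close> is not finitely generated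
(\<open>not_FGFPa_wreath2_times_integer\<close>, \<open>kernel_exponent_sum_not_fg\<close>).

The commutator subgroup of \<open>H\<close> nevertheless is finitely generated: it consists of the
pairs whose product lies in \<open>F'\<close>, and the swap provides all pairs \<open>(x,
x\<^sup>-\<^sup>1)\<close>, finitely many of which generate (\<open>fg_derived_wreath2\<close>).

It remains to control all automorphisms of \<open>H\<close>. The elements of the two factors are
recognised inside \<open>H\<close> by the size of their centralizers, since centralizers of
nontrivial elements of \<open>F\<close> are abelian; hence an automorphism preserves or exchanges
the two factors, and its fixed subgroup is, up to index two, \<open>Fix \<alpha> \<times> Fix
\<beta>\<close> or a copy of \<open>Fix (\<beta> \<circ> \<alpha>)\<close> for endomorphisms
\<open>\<alpha>\<close>, \<open>\<beta>\<close> of \<open>F\<close> (\<open>FGFPa_wreath2\<close>).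
So everything rests on the theorem that the fixed subgroup of an endomorphism of a finitely
generated free group is finitely generated, which is proved following Goldstein and Turner
(\<open>Fix_finitely_generated\<close>).

The free group is realised as Sanov's group of integer matrices. There the abelian centralizers are
a polynomial identity, and the first letter of the reduced word of a matrix can be read off from the
inner products of its rows, so that words never have to be introduced.
\<close>

section \<open>Finitely generated and fixed subgroups\<close>

context group
begin

lemma inv_cancel_left [simp]:
  "x \<in> carrier G \<Longrightarrow> y \<in> carrier G \<Longrightarrow> inv x \<otimes> (x \<otimes> y) = y"
  "x \<in> carrier G \<Longrightarrow> y \<in> carrier G \<Longrightarrow> x \<otimes> (inv x \<otimes> y) = y"
  by (simp_all add: m_assoc[symmetric])

end

lemma Fix_carrier: "Fix G \<phi> \<subseteq> carrier G"
  by (auto simp: Fix_def)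

lemma (in group) subgroup_Fix:
  assumes "\<phi> \<in> hom G G"
  shows "subgroup (Fix G \<phi>) G"
proof -
  interpret \<phi>: group_hom G G \<phi> by unfold_locales (rule assms)
  have "\<one> \<in> Fix G \<phi>" by (simp add: Fix_def)
  then show ?thesis by (intro subgroupI) (auto simp: Fix_def)
qed

lemma (in group_hom) fg_subgroup_image:
  assumes "fg_subgroup G N" "N \<subseteq> carrier G"
  shows "fg_subgroup H (h ` N)"
proof -
  obtain S where S: "finite S" "S \<subseteq> N" "generate G S = N"
    using assms(1) unfolding fg_subgroup_def by blast
  then have "generate H (h ` S) = h ` N" using generate_img[of S] assms(2) by auto
  then show ?thesis using S unfolding fg_subgroup_def by blast
qed

lemma FGFPa_iso:
  assumes G: "group G" and K: "group K" and h: "h \<in> iso G K" and "FGFPa G"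
  shows "FGFPa K"
  unfolding FGFPa_def
proof
  fix \<phi> assume \<phi>: "\<phi> \<in> iso K K"
  interpret h: group_hom G K h
    using G K h by (simp add: group_hom_def group_hom_axioms_def iso_def)
  let ?h' = "inv_into (carrier G) h"
  have h': "?h' \<in> iso K G" by (rule group.iso_set_sym[OF G h])
  have bij: "bij_betw h (carrier G) (carrier K)" using h by (simp add: iso_def)
  have "?h' \<circ> (\<phi> \<circ> h) \<in> iso G G"
    using iso_set_trans[OF iso_set_trans[OF h \<phi>] h'] by simp
  then have "fg_subgroup G (Fix G (?h' \<circ> (\<phi> \<circ> h)))"
    using \<open>FGFPa G\<close> by (simp add: FGFPa_def)
  then have "fg_subgroup K (h ` Fix G (?h' \<circ> (\<phi> \<circ> h)))"
    by (rule h.fg_subgroup_image[OF _ Fix_carrier])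
  moreover have "h ` Fix G (?h' \<circ> (\<phi> \<circ> h)) = Fix K \<phi>"
  proof
    have \<phi>_closed: "\<phi> k \<in> carrier K" if "k \<in> carrier K" for k
      using \<phi> that by (auto simp: iso_def hom_def)
    show "h ` Fix G (?h' \<circ> (\<phi> \<circ> h)) \<subseteq> Fix K \<phi>"
    proof
      fix k assume "k \<in> h ` Fix G (?h' \<circ> (\<phi> \<circ> h))"
      then obtain g where g: "k = h g" "g \<in> carrier G" "?h' (\<phi> (h g)) = g"
        by (auto simp: Fix_def)
      then have "\<phi> (h g) = h g"
        using bij_betw_inv_into_right[OF bij \<phi>_closed[of "h g"]] by simp
      then show "k \<in> Fix K \<phi>" using g by (simp add: Fix_def)
    qed
    show "Fix K \<phi> \<subseteq> h ` Fix G (?h' \<circ> (\<phi> \<circ> h))"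
    proof
      fix k assume k: "k \<in> Fix K \<phi>"
      then have "h (?h' k) = k" "?h' k \<in> carrier G"
        using bij_betw_inv_into_right[OF bij] bij_betw_inv_into[OF bij]
        by (auto simp: Fix_def bij_betw_def)
      then show "k \<in> h ` Fix G (?h' \<circ> (\<phi> \<circ> h))"
        using k by (intro image_eqI[of _ _ "?h' k"]) (auto simp: Fix_def)
    qed
  qed
  ultimately show "fg_subgroup K (Fix K \<phi>)" by simp
qed

text \<open>
The set \<open>B\<close> plays the role of a subgroup of index two: modulo \<open>B\<close>, a
single element \<open>t\<close> of \<open>F\<close> outside \<open>B\<close> accounts for all the
others, and it is added to the generators.
\<close>
lemma (in group) fg_subgroup_index_two:
  assumes F: "subgroup F G" and fg: "fg_subgroup G (F \<inter> B)"
    and index: "\<And>g t. g \<in> F \<Longrightarrow> t \<in> F \<Longrightarrow> g \<notin> B \<Longrightarrow> t \<notin> B \<Longrightarrow> g \<otimes> inv t \<in> B"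
  shows "fg_subgroup G F"
proof (cases "F \<subseteq> B")
  case True
  then show ?thesis using fg by (simp add: Int_absorb2)
next
  case False
  then obtain t where t: "t \<in> F" "t \<notin> B" by blast
  interpret F: subgroup F G by (rule F)
  obtain S where S: "finite S" "S \<subseteq> F \<inter> B" "generate G S = F \<inter> B"
    using fg unfolding fg_subgroup_def by blast
  have "F \<subseteq> generate G (insert t S)"
  proof
    fix g assume g: "g \<in> F"
    have sub: "F \<inter> B \<subseteq> generate G (insert t S)"
      using mono_generate[of S "insert t S"] S(3) by auto
    show "g \<in> generate G (insert t S)"
    proof (cases "g \<in> B")
      case True
      then show ?thesis using g sub by blast
    next
      case False
      then have "g \<otimes> inv t \<in> generate G (insert t S)"
        using sub index[OF g t(1) False t(2)] g t(1) by auto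
      moreover have "t \<in> generate G (insert t S)" by (simp add: generate.incl)
      ultimately have "g \<otimes> inv t \<otimes> t \<in> generate G (insert t S)" by (rule generate.eng)
      then show ?thesis using g t(1) by (simp add: m_assoc)
    qed
  qed
  moreover have "generate G (insert t S) \<subseteq> F"
    using S(2) t(1) by (intro generate_subgroup_incl[OF _ F]) auto
  ultimately show ?thesis
    using S t unfolding fg_subgroup_def by (intro exI[of _ "insert t S"]) auto
qed

section \<open>Coordinates on the components of a functional graph\<close>

text \<open>
A component of the graph with edges \<open>v \<rightarrow> f v\<close> contains at most one cycle.
This is expressed as follows. With \<open>r v\<close> a root of the component of \<open>v\<close>,
let \<open>k v\<close> and \<open>l v\<close> be the lengths of the shortest forward paths from
\<open>v\<close> and from \<open>r v\<close> to a common vertex. Along an edge these coordinates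
change in the way they would in a tree, except for the one edge per component that closes the cycle.
Such an exceptional vertex \<open>v\<close> is the last one on the forward orbit of its root, which
makes it unique.
\<close>
lemma functional_graph_coordinates:
  fixes f :: "'v \<Rightarrow> 'v" and r :: "'v \<Rightarrow> 'v" and S :: "'v set"
  assumes fS: "\<And>v. v \<in> S \<Longrightarrow> f v \<in> S"
    and rf: "\<And>v. v \<in> S \<Longrightarrow> r (f v) = r v"
    and meet: "\<And>v. v \<in> S \<Longrightarrow> \<exists>k l. (f ^^ k) v = (f ^^ l) (r v)"
    and fin: "finite (r ` S)"
  obtains k l :: "'v \<Rightarrow> nat"
  where "\<And>v. v \<in> S \<Longrightarrow> (f ^^ k v) v = (f ^^ l v) (r v)"
    and "finite {v \<in> S. \<not> (k v = Suc (k (f v)) \<and> l (f v) = l v \<or>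
                            k v = 0 \<and> k (f v) = 0 \<and> l (f v) = Suc (l v))}"
proof -
  define k where "k v = (LEAST k. \<exists>l. (f ^^ k) v = (f ^^ l) (r v))" for v
  define l where "l v = (LEAST l. (f ^^ k v) v = (f ^^ l) (r v))" for v
  have k_ex: "\<exists>l. (f ^^ k v) v = (f ^^ l) (r v)" if "v \<in> S" for v
    unfolding k_def using meet[OF that] by (rule LeastI_ex)
  have kl: "(f ^^ k v) v = (f ^^ l v) (r v)" if "v \<in> S" for v
    unfolding l_def using k_ex[OF that] by (rule LeastI_ex)
  have k_le: "k v \<le> i" if "(f ^^ i) v = (f ^^ j) (r v)" for v i j
    unfolding k_def using that by (intro Least_le) blast
  have l_le: "l v \<le> j" if "(f ^^ k v) v = (f ^^ j) (r v)" for v j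
    unfolding l_def using that by (intro Least_le)
  define E where "E = {v \<in> S. \<not> (k v = Suc (k (f v)) \<and> l (f v) = l v \<or>
                            k v = 0 \<and> k (f v) = 0 \<and> l (f v) = Suc (l v))}"
  have E: "k v = 0 \<and> k (f v) = 0 \<and> l (f v) \<le> l v" if "v \<in> E" for v
  proof -
    have v: "v \<in> S" using that by (simp add: E_def)
    note fv = fS[OF v]
    show ?thesis
    proof (cases "k v")
      case 0
      then have "f v = (f ^^ Suc (l v)) (r (f v))"
        using kl[OF v] rf[OF v] by simp
      then have "(f ^^ 0) (f v) = (f ^^ Suc (l v)) (r (f v))" by simp
      from k_le[OF this] this have "k (f v) = 0" "l (f v) \<le> Suc (l v)"
        using l_le[of "f v" "Suc (l v)"] by auto
      then show ?thesis using that 0 by (auto simp: E_def)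
    next
      case (Suc m)
      have "(f ^^ m) (f v) = (f ^^ l v) (r (f v))"
        using kl[OF v] rf[OF v] Suc by (simp add: funpow_swap1)
      from k_le[OF this] have "k (f v) \<le> m" .
      moreover have "(f ^^ Suc (k (f v))) v = (f ^^ l (f v)) (r v)"
        using kl[OF fv] rf[OF v] by (simp add: funpow_swap1)
      from k_le[OF this] have "m \<le> k (f v)" using Suc by simp
      ultimately have m: "k (f v) = m" by simp
      have "l (f v) = l v"
        unfolding l_def m Suc rf[OF v] by (simp add: funpow_swap1)
      then show ?thesis using that m Suc by (auto simp: E_def)
    qed
  qed
  \<comment> \<open>The forward orbit of the root has no further vertices after an exceptional one.\<close>
  have le: "l w \<le> l v" if "v \<in> E" "w \<in> E" "r v = r w" for v w
  proof -
    have v: "v \<in> S" "k v = 0" "k (f v) = 0" "l (f v) \<le> l v" and w: "w \<in> S" "k w = 0"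
      using E that by (auto simp: E_def)
    have cyc: "(f ^^ Suc (l v)) (r v) = (f ^^ l (f v)) (r v)"
      using kl[OF v(1)] kl[OF fS[OF v(1)]] v rf[OF v(1)] by simp
    have "\<exists>i\<le>l v. (f ^^ n) (r v) = (f ^^ i) (r v)" for n
    proof (induction n)
      case (Suc n)
      then obtain i where i: "i \<le> l v" "(f ^^ n) (r v) = (f ^^ i) (r v)" by auto
      then have "(f ^^ Suc n) (r v) = (f ^^ Suc i) (r v)" by simp
      then show ?case using cyc v(4) i(1) by (metis Suc_leI le_neq_implies_less)
    qed auto
    then obtain i where "i \<le> l v" "(f ^^ l w) (r v) = (f ^^ i) (r v)" by blast
    then show ?thesis using l_le[of w i] kl[OF w(1)] that(3) by auto
  qed
  have "inj_on r E"
  proof (rule inj_onI)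
    fix v w assume vw: "v \<in> E" "w \<in> E" "r v = r w"
    then have "l v = l w" using le[OF vw] le[OF vw(2,1)] by simp
    moreover have "v = (f ^^ l v) (r v)" "w = (f ^^ l w) (r w)"
      using kl[of v] kl[of w] E[OF vw(1)] E[OF vw(2)] vw by (auto simp: E_def)
    ultimately show "v = w" using vw(3) by simp
  qed
  moreover have "finite (r ` E)" using fin by (rule rev_finite_subset) (auto simp: E_def)
  ultimately have "finite E" by (rule finite_imageD[rotated])
  then show ?thesis using that[of k l] kl unfolding E_def by blast
qed

section \<open>Free groups by first letters\<close>

text \<open>
A finitely generated free group, without words (or a free product of it with groups of order two, as
a letter may be its own inverse): \<open>A\<close> consists of the free generators and their
inverses, \<open>first g\<close> is the first letter of the reduced word of \<open>g\<close> (and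
\<open>\<one>\<close> for the empty word), and \<open>len\<close> is any measure that decreases when
the first letter is cancelled. The word length itself is one, but for matrices a quadratic form is
more convenient.
\<close>
locale first_letter_group = group G for G (structure) +
  fixes A :: "'a set" and first :: "'a \<Rightarrow> 'a" and len :: "'a \<Rightarrow> nat"
  assumes finite_A: "finite A"
    and A_carrier: "A \<subseteq> carrier G"
    and A_inv: "x \<in> A \<Longrightarrow> inv x \<in> A"
    and one_notin_A: "\<one> \<notin> A"
    and first_one: "first \<one> = \<one>"
    and first_in: "g \<in> carrier G \<Longrightarrow> g \<noteq> \<one> \<Longrightarrow> first g \<in> A"
    and first_mult: "x \<in> A \<Longrightarrow> g \<in> carrier G \<Longrightarrow> first g \<noteq> inv x \<Longrightarrow> first (x \<otimes> g) = x"
    and len_less: "g \<in> carrier G \<Longrightarrow> g \<noteq> \<one> \<Longrightarrow> len (inv (first g) \<otimes> g) < len g"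
begin

lemma A_closed [simp]: "x \<in> A \<Longrightarrow> x \<in> carrier G"
  using A_carrier by blast

lemma first_carrier [simp]: "g \<in> carrier G \<Longrightarrow> first g \<in> carrier G"
  using first_in[of g] first_one by (cases "g = \<one>") auto

lemma first_letter: "x \<in> A \<Longrightarrow> first x = x"
  using first_mult[of x \<one>] first_one A_inv[of x] one_notin_A by fastforce

lemma first_strip:
  assumes "g \<in> carrier G" "g \<noteq> \<one>"
  shows "first (inv (first g) \<otimes> g) \<noteq> inv (first g)"
proof
  assume eq: "first (inv (first g) \<otimes> g) = inv (first g)"
  have "inv (first g) \<otimes> g \<noteq> \<one>"
    using eq first_one one_notin_A A_inv[OF first_in[OF assms]] by auto
  then have "len (inv (inv (first g)) \<otimes> (inv (first g) \<otimes> g)) < len (inv (first g) \<otimes> g)"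
    using len_less[of "inv (first g) \<otimes> g"] eq assms by simp
  moreover have "len (inv (first g) \<otimes> g) < len g" by (rule len_less[OF assms])
  ultimately show False using assms by simp
qed

lemma reduced_induct [consumes 1, case_names one step]:
  assumes g: "g \<in> carrier G" and one: "P \<one>"
    and step: "\<And>x h. x \<in> A \<Longrightarrow> h \<in> carrier G \<Longrightarrow> first h \<noteq> inv x \<Longrightarrow> P h \<Longrightarrow> P (x \<otimes> h)"
  shows "P g"
  using g
proof (induction "len g" arbitrary: g rule: less_induct)
  case less
  show ?case
  proof (cases "g = \<one>")
    case False
    have "P (first g \<otimes> (inv (first g) \<otimes> g))"
      using less False by (intro step first_in first_strip less len_less) auto
    then show ?thesis using less.prems by simp
  qed (simp add: one)
qed

lemma generate_A: "generate G A = carrier G"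
proof (rule antisym)
  show "carrier G \<subseteq> generate G A"
  proof
    fix g assume "g \<in> carrier G"
    then show "g \<in> generate G A"
      by (induction rule: reduced_induct) (auto intro: generate.intros)
  qed
qed (rule generate_incl[OF A_carrier])

lemma first_mult_right:
  assumes "g \<in> carrier G" "x \<in> A" "g \<noteq> \<one>" "g \<otimes> x \<noteq> \<one>"
  shows "first (g \<otimes> x) = first g"
  using assms(1,3,4)
proof (induction rule: reduced_induct)
  case one
  then show ?case by simp
next
  case (step y h)
  have "first (h \<otimes> x) \<noteq> inv y"
  proof (cases "h = \<one>")
    case True
    have "x \<noteq> inv y" using step.prems step.hyps True by auto
    then show ?thesis using True first_letter assms(2) by simp
  next
    case False
    then show ?thesis
      using step first_one A_inv[OF step.hyps(1)] one_notin_A by (cases "h \<otimes> x = \<one>") auto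
  qed
  then have "first (y \<otimes> (h \<otimes> x)) = y"
    using step.hyps assms by (intro first_mult) auto
  then show ?case
    using step.hyps assms(2) first_mult[OF step.hyps(1-3)] by (simp add: m_assoc)
qed

text \<open>
Multiplying on the right by \<open>u\<close> can change the first letter only of elements that are
cancelled completely on the way; this is the finiteness on which the theorem on fixed subgroups
relies.
\<close>
lemma finite_letter_change:
  assumes "u \<in> carrier G"
  shows "finite {h \<in> carrier G. first (h \<otimes> u) \<noteq> first h}"
  using assms
proof (induction rule: reduced_induct)
  case one
  show ?case by (simp cong: conj_cong)
next
  case (step x u)
  let ?B = "{h \<in> carrier G. first (h \<otimes> u) \<noteq> first h}"
  have "{h \<in> carrier G. first (h \<otimes> (x \<otimes> u)) \<noteq> first h} \<subseteq> {\<one>, inv x} \<union> (\<lambda>h. h \<otimes> inv x) ` ?B"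
  proof
    fix h assume h: "h \<in> {h \<in> carrier G. first (h \<otimes> (x \<otimes> u)) \<noteq> first h}"
    show "h \<in> {\<one>, inv x} \<union> (\<lambda>h. h \<otimes> inv x) ` ?B"
    proof (cases "h = \<one> \<or> h \<otimes> x = \<one>")
      case True
      then show ?thesis using h step.hyps inv_equality[of h x] by auto
    next
      case False
      then have "first (h \<otimes> x) = first h" using h step.hyps by (intro first_mult_right) auto
      then have "h \<otimes> x \<in> ?B" using h step.hyps by (auto simp: m_assoc)
      moreover have "h = h \<otimes> x \<otimes> inv x" using h step.hyps by (simp add: m_assoc)
      ultimately show ?thesis by blast
    qed
  qed
  then show ?case using step.IH by (auto intro: finite_subset)
qed

lemma right_induct [consumes 1, case_names one step]:
  assumes g: "g \<in> carrier G" and one: "P \<one>"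
    and step: "\<And>h x. h \<in> carrier G \<Longrightarrow> x \<in> A \<Longrightarrow> P h \<Longrightarrow> P (h \<otimes> x)"
  shows "P g"
proof -
  have "P (inv h)" if "h \<in> carrier G" for h
    using that
  proof (induction rule: reduced_induct)
    case (step x h)
    then have "P (inv h \<otimes> inv x)" by (intro assms(3)) (auto intro: A_inv)
    then show ?case using step by (simp add: inv_mult_group)
  qed (simp add: one)
  from this[of "inv g"] show ?thesis using g by simp
qed

end

section \<open>Fixed subgroups of endomorphisms of free groups\<close>

context first_letter_group
begin

text \<open>
The argument of Goldstein and Turner. The group acts on its underlying set from the right by
\<open>v \<cdot> w = w\<^sup>-\<^sup>1 v \<phi>(w)\<close>, and \<open>Fix \<phi>\<close> is the
stabilizer of \<open>\<one>\<close>. Hence it is generated by the Schreier generators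
\<open>\<sigma> v x\<close>, which are indexed by the edges \<open>v \<rightarrow> v \<cdot>
x\<close> of the orbit of \<open>\<one>\<close>, with \<open>x\<close> a letter. It has to be shown
that for a suitable transversal \<open>T\<close> only finitely many of them are nontrivial. Most
edges cancel the first letter of one of their endpoints, in one direction or the other, because by
\<open>finite_letter_change\<close> only finitely many edges fail to do so. Cancelling the first
letter, \<open>f v = v \<cdot> first v\<close>, is a function, so these edges form a functional
graph. Its components meeting the orbit are finitely many, as each is the component of
\<open>\<one>\<close> or is entered by a bad edge, and each contains at most one cycle. If
\<open>T\<close> follows the edges of this graph, then the Schreier generators are trivial on all
edges but the bad ones and at most one in each component.
\<close>
theorem Fix_finitely_generated:
  assumes \<phi>: "\<phi> \<in> hom G G"
  shows "fg_subgroup G (Fix G \<phi>)"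
proof -
  interpret \<phi>: group_hom G G \<phi>
    by unfold_locales (rule \<phi>)
  define act where "act v w = inv w \<otimes> v \<otimes> \<phi> w" for v w
  have act_closed [simp]: "act v w \<in> carrier G" if "v \<in> carrier G" "w \<in> carrier G" for v w
    using that by (simp add: act_def)
  have act_one [simp]: "act v \<one> = v" if "v \<in> carrier G" for v
    using that by (simp add: act_def)
  have act_act: "act (act v w) w' = act v (w \<otimes> w')"
    if "v \<in> carrier G" "w \<in> carrier G" "w' \<in> carrier G" for v w w'
    using that by (simp add: act_def m_assoc inv_mult_group)
  have act_inv [simp]: "act (act v w) (inv w) = v" if "v \<in> carrier G" "w \<in> carrier G" for v w
    using that by (simp add: act_act)
  have Fix_iff: "w \<in> Fix G \<phi> \<longleftrightarrow> w \<in> carrier G \<and> act \<one> w = \<one>" for w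
    using inv_solve_left[of \<one> w "\<phi> w"] by (auto simp: Fix_def act_def)
  define S where "S = act \<one> ` carrier G"
  have S_carrier [simp]: "v \<in> carrier G" if "v \<in> S" for v
    using that by (auto simp: S_def)
  have S_act [simp]: "act v w \<in> S" if "v \<in> S" "w \<in> carrier G" for v w
    using that by (auto simp: S_def act_act)
  have one_S [simp]: "\<one> \<in> S" by (auto simp: S_def intro!: image_eqI[of _ _ \<one>])

  define f where "f v = act v (first v)" for v
  have f_S [simp]: "f v \<in> S" if "v \<in> S" for v using that by (simp add: f_def)
  have fn_S [simp]: "(f ^^ n) v \<in> S" if "v \<in> S" for v n using that by (induction n) auto
  define adj where "adj v w \<longleftrightarrow> (\<exists>i j. (f ^^ i) v = (f ^^ j) w)" for v w
  have adj_refl: "adj v v" for v unfolding adj_def by blast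
  have adj_sym: "adj v w \<Longrightarrow> adj w v" for v w unfolding adj_def by metis
  have adj_trans: "adj u w" if uv: "adj u v" and vw: "adj v w" for u v w
  proof -
    from uv vw obtain i j i' j' where "(f ^^ i) u = (f ^^ j) v" "(f ^^ i') v = (f ^^ j') w"
      unfolding adj_def by blast
    then have "(f ^^ (i' + i)) u = (f ^^ (j + j')) w"
      by (metis add.commute comp_apply funpow_add)
    then show ?thesis unfolding adj_def by blast
  qed
  have adj_f: "adj v (f v)" for v
    unfolding adj_def by (rule exI[of _ 1], rule exI[of _ 0]) simp

  \<comment> \<open>The edges that cancel no first letter at either end.\<close>
  define Bad where "Bad = {(v, x). v \<in> S \<and> x \<in> A \<and> first v \<noteq> x \<and> first (act v x) \<noteq> inv x}"
  have "Bad \<subseteq> (\<Union>x\<in>A. (\<lambda>h. (x \<otimes> h, x)) ` {h \<in> carrier G. first (h \<otimes> \<phi> x) \<noteq> first h})"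
  proof (clarify)
    fix v x assume "(v, x) \<in> Bad"
    then have v: "v \<in> S" "x \<in> A" "first v \<noteq> x" "first (act v x) \<noteq> inv x"
      by (auto simp: Bad_def)
    then have "first (inv x \<otimes> v) = inv x" by (intro first_mult A_inv) auto
    then have "inv x \<otimes> v \<in> {h \<in> carrier G. first (h \<otimes> \<phi> x) \<noteq> first h}"
      using v by (simp add: act_def)
    then show "(v, x) \<in> (\<Union>x\<in>A. (\<lambda>h. (x \<otimes> h, x)) ` {h \<in> carrier G. first (h \<otimes> \<phi> x) \<noteq> first h})"
      using v by (intro UN_I[of x] image_eqI[of _ _ "inv x \<otimes> v"]) auto
  qed
  then have finite_Bad: "finite Bad"
    by (rule finite_subset) (intro finite_UN_I finite_A finite_imageI finite_letter_change, simp)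

  \<comment> \<open>Every component of the functional graph of \<open>f\<close> in the orbit contains an element of this set.\<close>
  define R where "R = insert \<one> ((\<lambda>(v, x). act v x) ` Bad)"
  have finite_R: "finite R" using finite_Bad by (simp add: R_def)
  have R_S: "v \<in> S" if "v \<in> R" for v using that by (auto simp: R_def Bad_def)
  have near_R: "\<exists>u\<in>R. adj u v" if "v \<in> S" for v
  proof -
    have "\<exists>u\<in>R. adj u (act \<one> w)" if "w \<in> carrier G" for w
      using that
    proof (induction rule: right_induct)
      case one
      then show ?case using adj_refl by (auto simp: R_def)
    next
      case (step w x)
      define v where "v = act \<one> w"
      have v: "v \<in> S" "act \<one> (w \<otimes> x) = act v x"
        using step by (simp_all add: v_def S_def act_act)
      consider "first v = x" | "first (act v x) = inv x" | "(v, x) \<in> Bad"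
        using step v by (auto simp: Bad_def)
      then show ?case
      proof cases
        case 1
        then have "act v x = f v" by (simp add: f_def)
        then show ?thesis using step.IH adj_trans[OF _ adj_f[of v]] v by (auto simp: v_def)
      next
        case 2
        then have "f (act v x) = v" using v step by (simp add: f_def)
        then show ?thesis using step.IH adj_trans[OF _ adj_sym[OF adj_f[of "act v x"]]] v by (auto simp: v_def)
      next
        case 3
        then show ?thesis using adj_refl v by (force simp: R_def)
      qed
    qed
    then show ?thesis using that by (auto simp: S_def)
  qed
  define r where "r v = (SOME u. u \<in> R \<and> adj u v)" for v
  have r: "r v \<in> R \<and> adj (r v) v" if "v \<in> S" for v
    unfolding r_def by (rule someI_ex) (use near_R[OF that] in blast)
  have r_S [simp]: "r v \<in> S" if "v \<in> S" for v using r[OF that] R_S by blast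
  have r_f: "r (f v) = r v" for v
  proof -
    have "adj u (f v) \<longleftrightarrow> adj u v" for u
      using adj_trans[OF _ adj_f[of v], of u] adj_trans[OF _ adj_sym[OF adj_f[of v]], of u] by blast
    then show ?thesis by (simp add: r_def)
  qed
  have fin_r: "finite (r ` S)" by (rule finite_subset[OF _ finite_R]) (use r in auto)
  have meet: "\<exists>i j. (f ^^ i) v = (f ^^ j) (r v)" if "v \<in> S" for v
    using adj_sym r[OF that] unfolding adj_def by blast
  obtain k l :: "'a \<Rightarrow> nat"
    where kl: "\<And>v. v \<in> S \<Longrightarrow> (f ^^ k v) v = (f ^^ l v) (r v)"
    and exc: "finite {v \<in> S. \<not> (k v = Suc (k (f v)) \<and> l (f v) = l v \<or>
                            k v = 0 \<and> k (f v) = 0 \<and> l (f v) = Suc (l v))}"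
    by (rule functional_graph_coordinates[of S f r, OF f_S r_f meet fin_r]) (assumption | rule that)+
  define E where "E = {v \<in> S. \<not> (k v = Suc (k (f v)) \<and> l (f v) = l v \<or>
                            k v = 0 \<and> k (f v) = 0 \<and> l (f v) = Suc (l v))}"

  \<comment> \<open>The product of the letters on the path from \<open>v\<close> to \<open>(f ^^ i) v\<close>.\<close>
  define lab where "lab = rec_nat (\<lambda>v. \<one>) (\<lambda>i h v. first v \<otimes> h (f v))"
  have lab_0 [simp]: "lab 0 v = \<one>" and lab_Suc: "lab (Suc i) v = first v \<otimes> lab i (f v)" for i v
    by (simp_all add: lab_def)
  have lab_closed [simp]: "lab i v \<in> carrier G" if "v \<in> S" for i v
    using that by (induction i arbitrary: v) (simp_all add: lab_Suc)
  have act_lab: "act v (lab i v) = (f ^^ i) v" if "v \<in> S" for i v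
    using that
  proof (induction i arbitrary: v)
    case (Suc i)
    have "act v (lab (Suc i) v) = act (f v) (lab i (f v))"
      using Suc.prems by (simp add: lab_Suc act_act f_def)
    then show ?case using Suc by (simp add: funpow_swap1)
  qed simp
  have lab_Suc': "lab (Suc i) v = lab i v \<otimes> first ((f ^^ i) v)" if "v \<in> S" for i v
    using that
  proof (induction i arbitrary: v)
    case (Suc i)
    have "lab (Suc (Suc i)) v = first v \<otimes> (lab i (f v) \<otimes> first ((f ^^ i) (f v)))"
      using Suc by (simp add: lab_Suc[of "Suc i"])
    then show ?case using Suc.prems by (simp add: lab_Suc m_assoc funpow_swap1)
  qed (simp add: lab_Suc)

  define T0 where "T0 u = (SOME w. w \<in> carrier G \<and> act \<one> w = u)" for u
  have T0: "T0 u \<in> carrier G \<and> act \<one> (T0 u) = u" if "u \<in> S" for u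
    unfolding T0_def by (rule someI_ex) (use that in \<open>auto simp: S_def\<close>)
  \<comment> \<open>Go from \<open>\<one>\<close> to the root of the component, along its forward orbit, and back up to \<open>v\<close>.\<close>
  define T where "T v = T0 (r v) \<otimes> lab (l v) (r v) \<otimes> inv (lab (k v) v)" for v
  have T_closed [simp]: "T v \<in> carrier G" if "v \<in> S" for v
    using that T0[of "r v"] by (simp add: T_def)
  have act_T: "act \<one> (T v) = v" if "v \<in> S" for v
  proof -
    have "act \<one> (T v) = act (act (act \<one> (T0 (r v))) (lab (l v) (r v))) (inv (lab (k v) v))"
      using that conjunct1[OF T0[of "r v"]] by (simp add: T_def act_act m_assoc)
    also have "\<dots> = act (act v (lab (k v) v)) (inv (lab (k v) v))"
      using that T0[of "r v"] by (simp add: act_lab kl)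
    also have "\<dots> = v" using that by simp
    finally show ?thesis .
  qed
  have T_f: "T (f v) = T v \<otimes> first v" if v: "v \<in> S" and "v \<notin> E" for v
  proof -
    have "k v = Suc (k (f v)) \<and> l (f v) = l v \<or> k v = 0 \<and> k (f v) = 0 \<and> l (f v) = Suc (l v)"
      using that by (simp add: E_def)
    then show ?thesis
    proof
      assume "k v = Suc (k (f v)) \<and> l (f v) = l v"
      then show ?thesis using v T0[of "r v"]
        by (simp add: T_def r_f lab_Suc inv_mult_group m_assoc)
    next
      assume "k v = 0 \<and> k (f v) = 0 \<and> l (f v) = Suc (l v)"
      then show ?thesis using v T0[of "r v"] kl[OF v]
        by (simp add: T_def r_f lab_Suc' m_assoc)
    qed
  qed

  define \<sigma> where "\<sigma> v x = T v \<otimes> x \<otimes> inv (T (act v x))" for v x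
  have \<sigma>_Fix: "\<sigma> v x \<in> Fix G \<phi>" if "v \<in> S" "x \<in> carrier G" for v x
  proof -
    have "act \<one> (\<sigma> v x) = act (act (act \<one> (T v)) x) (inv (T (act v x)))"
      using that by (simp add: \<sigma>_def act_act)
    also have "\<dots> = act (act \<one> (T (act v x))) (inv (T (act v x)))"
      using that by (simp add: act_T)
    also have "\<dots> = \<one>" using that by simp
    finally show ?thesis using that by (simp add: Fix_iff \<sigma>_def)
  qed
  \<comment> \<open>\<open>T \<one>\<close> is a generator because the transversal is not normalised to \<open>T \<one> = \<one>\<close>.\<close>
  define \<Gamma> where "\<Gamma> = insert (T \<one>) ((\<lambda>(v, x). \<sigma> v x) ` Bad \<union> (\<lambda>v. \<sigma> v (first v)) ` E)"
  have "finite \<Gamma>" using finite_Bad exc unfolding \<Gamma>_def E_def by blast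
  have "T \<one> \<in> Fix G \<phi>" by (simp add: Fix_iff act_T)
  then have \<Gamma>_Fix: "\<Gamma> \<subseteq> Fix G \<phi>"
    using \<sigma>_Fix by (auto simp: \<Gamma>_def Bad_def E_def)
  then have \<Gamma>_carrier: "\<Gamma> \<subseteq> carrier G" by (rule subset_trans[OF _ Fix_carrier])
  have \<sigma>_first: "\<sigma> v (first v) \<in> generate G \<Gamma>" if "v \<in> S" for v
  proof (cases "v \<in> E")
    case True
    then show ?thesis by (intro generate.incl) (auto simp: \<Gamma>_def)
  next
    case False
    then have "\<sigma> v (first v) = \<one>"
      using that T_f[OF that] by (simp add: \<sigma>_def f_def[symmetric])
    then show ?thesis by (simp add: generate.one)
  qed
  have \<sigma>_generate: "\<sigma> v x \<in> generate G \<Gamma>" if v: "v \<in> S" and x: "x \<in> A" for v x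
  proof -
    consider "first v = x" | "first (act v x) = inv x" | "(v, x) \<in> Bad"
      using v x by (auto simp: Bad_def)
    then show ?thesis
    proof cases
      case 1
      then show ?thesis using \<sigma>_first[OF v] by simp
    next
      case 2
      have "\<sigma> v x = inv (\<sigma> (act v x) (inv x))"
        using v x by (simp add: \<sigma>_def inv_mult_group m_assoc)
      then show ?thesis
        using \<sigma>_first[of "act v x"] v x 2 generate_m_inv_closed[OF \<Gamma>_carrier] by simp
    next
      case 3
      then show ?thesis by (intro generate.incl) (force simp: \<Gamma>_def)
    qed
  qed
  have transversal: "w \<otimes> inv (T (act \<one> w)) \<in> generate G \<Gamma>" if "w \<in> carrier G" for w
    using that
  proof (induction rule: right_induct)
    case one
    then show ?case by (auto intro: generate.inv simp: \<Gamma>_def)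
  next
    case (step w x)
    then have S: "act \<one> w \<in> S" by simp
    have "w \<otimes> x \<otimes> inv (T (act \<one> (w \<otimes> x))) = (w \<otimes> inv (T (act \<one> w))) \<otimes> \<sigma> (act \<one> w) x"
      using step S by (simp add: \<sigma>_def act_act[symmetric] m_assoc)
    then show ?case using step.IH \<sigma>_generate[OF S step.hyps(2)] by (simp add: generate.eng)
  qed
  have "generate G \<Gamma> = Fix G \<phi>"
  proof
    show "generate G \<Gamma> \<subseteq> Fix G \<phi>"
      by (rule generate_subgroup_incl[OF \<Gamma>_Fix subgroup_Fix[OF \<phi>]])
    show "Fix G \<phi> \<subseteq> generate G \<Gamma>"
    proof
      fix w assume w: "w \<in> Fix G \<phi>"
      then have "w = (w \<otimes> inv (T (act \<one> w))) \<otimes> T \<one>"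
        by (simp add: Fix_iff m_assoc)
      moreover have "T \<one> \<in> generate G \<Gamma>" by (auto intro: generate.incl simp: \<Gamma>_def)
      ultimately show "w \<in> generate G \<Gamma>"
        using w transversal[of w] by (metis generate.eng Fix_iff)
    qed
  qed
  then show ?thesis using \<open>finite \<Gamma>\<close> \<Gamma>_Fix unfolding fg_subgroup_def by blast
qed

end

section \<open>Homomorphisms on free groups\<close>

context first_letter_group
begin

function lift :: "('c, 'd) monoid_scheme \<Rightarrow> ('a \<Rightarrow> 'c) \<Rightarrow> 'a \<Rightarrow> 'c" where
  "lift K k g = (if g \<in> carrier G \<and> g \<noteq> \<one>
     then k (first g) \<otimes>\<^bsub>K\<^esub> lift K k (inv (first g) \<otimes> g) else \<one>\<^bsub>K\<^esub>)"
  by pat_completeness auto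
termination
  by (relation "measure (\<lambda>(K, k, g). len g)") (auto intro: len_less)

declare lift.simps [simp del]

lemma lift_one [simp]: "lift K k \<one> = \<one>\<^bsub>K\<^esub>"
  by (subst lift.simps) simp

lemma lift_reduced:
  assumes "x \<in> A" "h \<in> carrier G" "first h \<noteq> inv x"
  shows "lift K k (x \<otimes> h) = k x \<otimes>\<^bsub>K\<^esub> lift K k h"
proof -
  have "x \<otimes> h \<noteq> \<one>"
    using first_mult[OF assms] first_one one_notin_A assms(1) by auto
  then show ?thesis
    using assms first_mult[OF assms] by (subst lift.simps) simp
qed

lemma lift_closed:
  assumes "group K" "k \<in> A \<rightarrow> carrier K" "g \<in> carrier G"
  shows "lift K k g \<in> carrier K"
proof -
  interpret K: group K by fact
  show ?thesis
    using assms(3) by (induction rule: reduced_induct) (use assms(2) in \<open>auto simp: lift_reduced\<close>)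
qed

text \<open>
Also when \<open>x\<close> cancels the first letter of \<open>g\<close>: then \<open>g\<close> is
the reduced product of \<open>inv x\<close> and \<open>x \<otimes> g\<close>.
\<close>
lemma lift_letter_mult:
  assumes K: "group K" and k: "k \<in> A \<rightarrow> carrier K"
    and k_inv: "\<And>x. x \<in> A \<Longrightarrow> k (inv x) = inv\<^bsub>K\<^esub> k x"
    and x: "x \<in> A" and g: "g \<in> carrier G"
  shows "lift K k (x \<otimes> g) = k x \<otimes>\<^bsub>K\<^esub> lift K k g"
proof (cases "first g = inv x")
  interpret K: group K by (rule K)
  case True
  then have "first (x \<otimes> g) \<noteq> inv (inv x)"
    using first_strip[of g] g x first_one one_notin_A A_inv[OF x] by (cases "g = \<one>") auto
  then have "lift K k (inv x \<otimes> (x \<otimes> g)) = k (inv x) \<otimes>\<^bsub>K\<^esub> lift K k (x \<otimes> g)"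
    using x g by (intro lift_reduced A_inv) auto
  then show ?thesis
    using x g k k_inv lift_closed[OF K k, of "x \<otimes> g"] by (simp add: Pi_iff)
next
  case False
  then show ?thesis using x g by (intro lift_reduced)
qed

lemma lift_hom:
  assumes K: "group K" and k: "k \<in> A \<rightarrow> carrier K"
    and k_inv: "\<And>x. x \<in> A \<Longrightarrow> k (inv x) = inv\<^bsub>K\<^esub> k x"
  shows "lift K k \<in> hom G K"
proof (rule homI)
  interpret K: group K by (rule K)
  show "lift K k g \<in> carrier K" if "g \<in> carrier G" for g by (rule lift_closed[OF K k that])
  show "lift K k (g \<otimes> h) = lift K k g \<otimes>\<^bsub>K\<^esub> lift K k h"
    if "g \<in> carrier G" and h: "h \<in> carrier G" for g h
    using that(1)
  proof (induction rule: reduced_induct)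
    case one
    then show ?case using h lift_closed[OF K k] by simp
  next
    case (step x g)
    then show ?case
      using h lift_closed[OF K k] k
      by (simp add: m_assoc lift_letter_mult[OF K k k_inv] K.m_assoc Pi_iff)
  qed
qed

lemma lift_letter:
  assumes "group K" "k \<in> A \<rightarrow> carrier K" "x \<in> A"
  shows "lift K k x = k x"
proof -
  interpret K: group K by fact
  have "lift K k (x \<otimes> \<one>) = k x \<otimes>\<^bsub>K\<^esub> lift K k \<one>"
    using assms A_inv[OF assms(3)] first_one one_notin_A by (intro lift_reduced) auto
  then show ?thesis using assms by (simp add: Pi_iff)
qed

end

section \<open>The wreath product with the group of order two\<close>

text \<open>The flag tells whether the swap of the two factors is applied.\<close>
definition wreath2 :: "('a, 'b) monoid_scheme \<Rightarrow> (('a \<times> 'a) \<times> bool) monoid" where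
  "wreath2 G = \<lparr>carrier = (carrier G \<times> carrier G) \<times> UNIV,
     monoid.mult = (\<lambda>((p, q), b) ((p', q'), c).
       if b then ((p \<otimes>\<^bsub>G\<^esub> q', q \<otimes>\<^bsub>G\<^esub> p'), \<not> c) else ((p \<otimes>\<^bsub>G\<^esub> p', q \<otimes>\<^bsub>G\<^esub> q'), c)),
     monoid.one = ((\<one>\<^bsub>G\<^esub>, \<one>\<^bsub>G\<^esub>), False)\<rparr>"

lemma wreath2_simps [simp]:
  "((p, q), b) \<in> carrier (wreath2 G) \<longleftrightarrow> p \<in> carrier G \<and> q \<in> carrier G"
  "((p, q), False) \<otimes>\<^bsub>wreath2 G\<^esub> ((p', q'), c) = ((p \<otimes>\<^bsub>G\<^esub> p', q \<otimes>\<^bsub>G\<^esub> q'), c)"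
  "((p, q), True) \<otimes>\<^bsub>wreath2 G\<^esub> ((p', q'), c) = ((p \<otimes>\<^bsub>G\<^esub> q', q \<otimes>\<^bsub>G\<^esub> p'), \<not> c)"
  "\<one>\<^bsub>wreath2 G\<^esub> = ((\<one>\<^bsub>G\<^esub>, \<one>\<^bsub>G\<^esub>), False)"
  by (simp_all add: wreath2_def)

lemma wreath2_carrierE:
  assumes "x \<in> carrier (wreath2 G)"
  obtains p q b where "x = ((p, q), b)" "p \<in> carrier G" "q \<in> carrier G"
  using assms by (auto simp: wreath2_def)

context group
begin

lemma group_wreath2: "group (wreath2 G)"
proof (rule groupI)
  fix x y z assume "x \<in> carrier (wreath2 G)" "y \<in> carrier (wreath2 G)" "z \<in> carrier (wreath2 G)"
  then show "x \<otimes>\<^bsub>wreath2 G\<^esub> y \<otimes>\<^bsub>wreath2 G\<^esub> z = x \<otimes>\<^bsub>wreath2 G\<^esub> (y \<otimes>\<^bsub>wreath2 G\<^esub> z)"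
    by (elim wreath2_carrierE) (auto simp: wreath2_def m_assoc)
next
  fix x assume x: "x \<in> carrier (wreath2 G)"
  then obtain p q b where [simp]: "x = ((p, q), b)" "p \<in> carrier G" "q \<in> carrier G"
    by (rule wreath2_carrierE)
  show "\<exists>y\<in>carrier (wreath2 G). y \<otimes>\<^bsub>wreath2 G\<^esub> x = \<one>\<^bsub>wreath2 G\<^esub>"
    by (rule bexI[of _ "(if b then (inv q, inv p) else (inv p, inv q), b)"])
      (auto simp: wreath2_def)
qed (auto simp: wreath2_def)

interpretation W: group "wreath2 G" by (rule group_wreath2)

lemma inv_wreath2 [simp]:
  assumes "p \<in> carrier G" "q \<in> carrier G"
  shows "inv\<^bsub>wreath2 G\<^esub> ((p, q), False) = ((inv p, inv q), False)"
    and "inv\<^bsub>wreath2 G\<^esub> ((p, q), True) = ((inv q, inv p), True)"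
  using assms by (auto intro!: W.inv_equality)


abbreviation inl :: "'a \<Rightarrow> ('a \<times> 'a) \<times> bool" where
  "inl p \<equiv> ((p, \<one>), False)"

abbreviation inr :: "'a \<Rightarrow> ('a \<times> 'a) \<times> bool" where
  "inr q \<equiv> ((\<one>, q), False)"

lemma inl_hom: "inl \<in> hom G (wreath2 G)" and inr_hom: "inr \<in> hom G (wreath2 G)"
  by (auto intro!: homI)

text \<open>
Squares are considered in order to land in the base group. For \<open>y = (a, b) \<sigma>\<close>
commuting with \<open>(p, q)\<close> one has \<open>p a = a q\<close> and \<open>q b = b p\<close>,
hence the components \<open>a b\<close> and \<open>b a\<close> of \<open>y\<^sup>2\<close>
centralize \<open>p\<close> and \<open>q\<close>.
\<close>
lemma wreath2_square_centralizer:
  assumes p: "p \<in> carrier G" and q: "q \<in> carrier G" and y: "y \<in> carrier (wreath2 G)"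
    and comm: "((p, q), False) \<otimes>\<^bsub>wreath2 G\<^esub> y = y \<otimes>\<^bsub>wreath2 G\<^esub> ((p, q), False)"
  obtains u v where "y \<otimes>\<^bsub>wreath2 G\<^esub> y = ((u, v), False)"
    "u \<in> carrier G" "v \<in> carrier G" "p \<otimes> u = u \<otimes> p" "q \<otimes> v = v \<otimes> q"
proof -
  obtain a b c where y': "y = ((a, b), c)" "a \<in> carrier G" "b \<in> carrier G"
    using y by (rule wreath2_carrierE)
  show ?thesis
  proof (cases c)
    case True
    then have c: "p \<otimes> a = a \<otimes> q" "q \<otimes> b = b \<otimes> p" using comm y' by auto
    have "p \<otimes> (a \<otimes> b) = a \<otimes> b \<otimes> p"
      using c p q y' by (metis m_assoc)
    moreover have "q \<otimes> (b \<otimes> a) = b \<otimes> a \<otimes> q"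
      using c p q y' by (metis m_assoc)
    ultimately show ?thesis using y' True by (intro that[of "a \<otimes> b" "b \<otimes> a"]) auto
  next
    case False
    then have c: "p \<otimes> a = a \<otimes> p" "q \<otimes> b = b \<otimes> q" using comm y' by auto
    have "p \<otimes> (a \<otimes> a) = a \<otimes> a \<otimes> p" "q \<otimes> (b \<otimes> b) = b \<otimes> b \<otimes> q"
      using c p q y' by (metis m_assoc)+
    then show ?thesis using y' False by (intro that[of "a \<otimes> a" "b \<otimes> b"]) auto
  qed
qed

end

lemma (in group) subgroup_wreath2_base:
  "subgroup {x \<in> carrier (wreath2 G). \<not> snd x} (wreath2 G)"
proof (rule group.subgroupI[OF group_wreath2])
  show "{x \<in> carrier (wreath2 G). \<not> snd x} \<noteq> {}"
    using group.is_monoid[OF group_wreath2, THEN monoid.one_closed] by (auto simp: wreath2_def)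
  fix x assume "x \<in> {x \<in> carrier (wreath2 G). \<not> snd x}"
  then show "inv\<^bsub>wreath2 G\<^esub> x \<in> {x \<in> carrier (wreath2 G). \<not> snd x}"
    by (auto elim!: wreath2_carrierE)
next
  fix x y assume "x \<in> {x \<in> carrier (wreath2 G). \<not> snd x}" "y \<in> {x \<in> carrier (wreath2 G). \<not> snd x}"
  then show "x \<otimes>\<^bsub>wreath2 G\<^esub> y \<in> {x \<in> carrier (wreath2 G). \<not> snd x}"
    by (auto elim!: wreath2_carrierE)
qed auto

section \<open>Automorphisms of the wreath product\<close>

text \<open>
A property invariant under automorphisms, chosen to single out the nontrivial elements of the two
factors of a wreath product: their centralizers are large, but those of other elements of the base
group are abelian up to index two, which the squares take care of. The condition \<open>x\<^sup>2
\<noteq> \<one>\<close> excludes the conjugates of the swap, whose centralizers contain a diagonal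
copy of the group.
\<close>
definition wide_elements :: "('a, 'b) monoid_scheme \<Rightarrow> 'a set" where
  "wide_elements K = {x \<in> carrier K. x \<otimes>\<^bsub>K\<^esub> x \<noteq> \<one>\<^bsub>K\<^esub> \<and>
     (\<exists>y\<in>carrier K. \<exists>z\<in>carrier K. x \<otimes>\<^bsub>K\<^esub> y = y \<otimes>\<^bsub>K\<^esub> x \<and> x \<otimes>\<^bsub>K\<^esub> z = z \<otimes>\<^bsub>K\<^esub> x \<and>
        (y \<otimes>\<^bsub>K\<^esub> y) \<otimes>\<^bsub>K\<^esub> (z \<otimes>\<^bsub>K\<^esub> z) \<noteq> (z \<otimes>\<^bsub>K\<^esub> z) \<otimes>\<^bsub>K\<^esub> (y \<otimes>\<^bsub>K\<^esub> y))}"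

lemma wide_elementsI:
  assumes "x \<in> carrier K" "x \<otimes>\<^bsub>K\<^esub> x \<noteq> \<one>\<^bsub>K\<^esub>" "y \<in> carrier K" "z \<in> carrier K"
    "x \<otimes>\<^bsub>K\<^esub> y = y \<otimes>\<^bsub>K\<^esub> x" "x \<otimes>\<^bsub>K\<^esub> z = z \<otimes>\<^bsub>K\<^esub> x"
    "(y \<otimes>\<^bsub>K\<^esub> y) \<otimes>\<^bsub>K\<^esub> (z \<otimes>\<^bsub>K\<^esub> z) \<noteq> (z \<otimes>\<^bsub>K\<^esub> z) \<otimes>\<^bsub>K\<^esub> (y \<otimes>\<^bsub>K\<^esub> y)"
  shows "x \<in> wide_elements K"
  using assms unfolding wide_elements_def by blast

lemma wide_elements_iso:
  assumes G: "group G" and \<phi>: "\<phi> \<in> iso G G" and x: "x \<in> wide_elements G"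
  shows "\<phi> x \<in> wide_elements G"
proof -
  interpret \<phi>: group_hom G G \<phi>
    using G \<phi> by (simp add: group_hom_def group_hom_axioms_def iso_def)
  have inj: "inj_on \<phi> (carrier G)" using \<phi> by (simp add: iso_def bij_betw_def)
  obtain y z where yz: "x \<in> carrier G" "y \<in> carrier G" "z \<in> carrier G" "x \<otimes>\<^bsub>G\<^esub> x \<noteq> \<one>\<^bsub>G\<^esub>"
    "x \<otimes>\<^bsub>G\<^esub> y = y \<otimes>\<^bsub>G\<^esub> x" "x \<otimes>\<^bsub>G\<^esub> z = z \<otimes>\<^bsub>G\<^esub> x"
    "(y \<otimes>\<^bsub>G\<^esub> y) \<otimes>\<^bsub>G\<^esub> (z \<otimes>\<^bsub>G\<^esub> z) \<noteq> (z \<otimes>\<^bsub>G\<^esub> z) \<otimes>\<^bsub>G\<^esub> (y \<otimes>\<^bsub>G\<^esub> y)"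
    using x unfolding wide_elements_def by blast
  have "\<phi> (x \<otimes>\<^bsub>G\<^esub> x) \<noteq> \<one>\<^bsub>G\<^esub>"
    using inj_onD[OF inj, of "x \<otimes>\<^bsub>G\<^esub> x" "\<one>\<^bsub>G\<^esub>"] yz by auto
  moreover have "\<phi> ((y \<otimes>\<^bsub>G\<^esub> y) \<otimes>\<^bsub>G\<^esub> (z \<otimes>\<^bsub>G\<^esub> z)) \<noteq> \<phi> ((z \<otimes>\<^bsub>G\<^esub> z) \<otimes>\<^bsub>G\<^esub> (y \<otimes>\<^bsub>G\<^esub> y))"
    using inj_onD[OF inj, of "(y \<otimes>\<^bsub>G\<^esub> y) \<otimes>\<^bsub>G\<^esub> (z \<otimes>\<^bsub>G\<^esub> z)" "(z \<otimes>\<^bsub>G\<^esub> z) \<otimes>\<^bsub>G\<^esub> (y \<otimes>\<^bsub>G\<^esub> y)"] yz by auto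
  moreover have "\<phi> (x \<otimes>\<^bsub>G\<^esub> y) = \<phi> (y \<otimes>\<^bsub>G\<^esub> x)" "\<phi> (x \<otimes>\<^bsub>G\<^esub> z) = \<phi> (z \<otimes>\<^bsub>G\<^esub> x)"
    using yz by simp_all
  ultimately show ?thesis
    using yz(1-3) by (intro wide_elementsI[of _ _ "\<phi> y" "\<phi> z"]) auto
qed

text \<open>
The properties of a nonabelian free group that serve to recognise the two factors of its wreath
product.
\<close>
locale thin_centralizer_group = group G for G (structure) +
  assumes centralizer_comm: "\<lbrakk>x \<in> carrier G; y \<in> carrier G; z \<in> carrier G; x \<noteq> \<one>;
      x \<otimes> y = y \<otimes> x; x \<otimes> z = z \<otimes> x\<rbrakk> \<Longrightarrow> y \<otimes> z = z \<otimes> y"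
    and no_involution: "\<lbrakk>x \<in> carrier G; x \<otimes> x = \<one>\<rbrakk> \<Longrightarrow> x = \<one>"
    and squares_noncomm: "\<exists>c\<in>carrier G. \<exists>d\<in>carrier G. (c \<otimes> c) \<otimes> (d \<otimes> d) \<noteq> (d \<otimes> d) \<otimes> (c \<otimes> c)"
begin

interpretation W: group "wreath2 G" by (rule group_wreath2)

lemma not_wide:
  assumes p: "p \<in> carrier G" "p \<noteq> \<one>" and q: "q \<in> carrier G" "q \<noteq> \<one>"
    and y: "y \<in> carrier (wreath2 G)" and z: "z \<in> carrier (wreath2 G)"
    and "((p, q), False) \<otimes>\<^bsub>wreath2 G\<^esub> y = y \<otimes>\<^bsub>wreath2 G\<^esub> ((p, q), False)"
    and "((p, q), False) \<otimes>\<^bsub>wreath2 G\<^esub> z = z \<otimes>\<^bsub>wreath2 G\<^esub> ((p, q), False)"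
  shows "(y \<otimes>\<^bsub>wreath2 G\<^esub> y) \<otimes>\<^bsub>wreath2 G\<^esub> (z \<otimes>\<^bsub>wreath2 G\<^esub> z) =
         (z \<otimes>\<^bsub>wreath2 G\<^esub> z) \<otimes>\<^bsub>wreath2 G\<^esub> (y \<otimes>\<^bsub>wreath2 G\<^esub> y)"
proof -
  obtain u v where uv: "y \<otimes>\<^bsub>wreath2 G\<^esub> y = ((u, v), False)"
    "u \<in> carrier G" "v \<in> carrier G" "p \<otimes> u = u \<otimes> p" "q \<otimes> v = v \<otimes> q"
    using wreath2_square_centralizer assms(1,3,5,7) by blast
  obtain u' v' where uv': "z \<otimes>\<^bsub>wreath2 G\<^esub> z = ((u', v'), False)"
    "u' \<in> carrier G" "v' \<in> carrier G" "p \<otimes> u' = u' \<otimes> p" "q \<otimes> v' = v' \<otimes> q"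
    using wreath2_square_centralizer assms(1,3,6,8) by blast
  show ?thesis
    using centralizer_comm[OF p(1) uv(2) uv'(2) p(2) uv(4) uv'(4)]
      centralizer_comm[OF q(1) uv(3) uv'(3) q(2) uv(5) uv'(5)] uv(1) uv'(1) by simp
qed

text \<open>
An element \<open>(p, q) \<sigma>\<close> is not wide because its centralizer is contained in that
of its square \<open>(p q, q p)\<close>, both of whose components are nontrivial if one is.
\<close>
lemma wide_elements_wreath2:
  "wide_elements (wreath2 G) = (inl ` carrier G \<union> inr ` carrier G) - {\<one>\<^bsub>wreath2 G\<^esub>}"
proof (intro equalityI subsetI)
  fix x assume "x \<in> wide_elements (wreath2 G)"
  then obtain y z where x: "x \<in> carrier (wreath2 G)" "x \<otimes>\<^bsub>wreath2 G\<^esub> x \<noteq> \<one>\<^bsub>wreath2 G\<^esub>"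
    and yz: "y \<in> carrier (wreath2 G)" "z \<in> carrier (wreath2 G)"
    and comm: "x \<otimes>\<^bsub>wreath2 G\<^esub> y = y \<otimes>\<^bsub>wreath2 G\<^esub> x" "x \<otimes>\<^bsub>wreath2 G\<^esub> z = z \<otimes>\<^bsub>wreath2 G\<^esub> x"
    and noncomm: "(y \<otimes>\<^bsub>wreath2 G\<^esub> y) \<otimes>\<^bsub>wreath2 G\<^esub> (z \<otimes>\<^bsub>wreath2 G\<^esub> z) \<noteq>
         (z \<otimes>\<^bsub>wreath2 G\<^esub> z) \<otimes>\<^bsub>wreath2 G\<^esub> (y \<otimes>\<^bsub>wreath2 G\<^esub> y)"
    unfolding wide_elements_def by blast
  obtain p q b where x': "x = ((p, q), b)" "p \<in> carrier G" "q \<in> carrier G"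
    using x(1) by (rule wreath2_carrierE)
  have "\<not> b"
  proof
    assume b
    then have sq: "x \<otimes>\<^bsub>wreath2 G\<^esub> x = ((p \<otimes> q, q \<otimes> p), False)" using x' by simp
    have "p \<otimes> q \<noteq> \<one>" using sq x(2) x' by (auto simp: inv_comm)
    moreover from this have "q \<otimes> p \<noteq> \<one>" using x' inv_comm by auto
    moreover have "(x \<otimes>\<^bsub>wreath2 G\<^esub> x) \<otimes>\<^bsub>wreath2 G\<^esub> y = y \<otimes>\<^bsub>wreath2 G\<^esub> (x \<otimes>\<^bsub>wreath2 G\<^esub> x)"
      "(x \<otimes>\<^bsub>wreath2 G\<^esub> x) \<otimes>\<^bsub>wreath2 G\<^esub> z = z \<otimes>\<^bsub>wreath2 G\<^esub> (x \<otimes>\<^bsub>wreath2 G\<^esub> x)"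
      using comm x(1) yz by (metis W.m_assoc)+
    ultimately show False
      using not_wide[of "p \<otimes> q" "q \<otimes> p" y z] x' yz noncomm unfolding sq by auto
  qed
  then have "p = \<one> \<or> q = \<one>"
    using not_wide[of p q y z] x' yz comm noncomm by auto
  then show "x \<in> (inl ` carrier G \<union> inr ` carrier G) - {\<one>\<^bsub>wreath2 G\<^esub>}"
    using x x' \<open>\<not> b\<close> by auto
next
  fix x assume x: "x \<in> (inl ` carrier G \<union> inr ` carrier G) - {\<one>\<^bsub>wreath2 G\<^esub>}"
  obtain c d where cd: "c \<in> carrier G" "d \<in> carrier G" "(c \<otimes> c) \<otimes> (d \<otimes> d) \<noteq> (d \<otimes> d) \<otimes> (c \<otimes> c)"
    using squares_noncomm by blast
  from x consider p where "p \<in> carrier G" "p \<noteq> \<one>" "x = inl p"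
    | p where "p \<in> carrier G" "p \<noteq> \<one>" "x = inr p" by auto
  then show "x \<in> wide_elements (wreath2 G)"
  proof cases
    case 1
    then show ?thesis using cd no_involution[of p]
      by (intro wide_elementsI[of _ _ "inr c" "inr d"]) auto
  next
    case 2
    then show ?thesis using cd no_involution[of p]
      by (intro wide_elementsI[of _ _ "inl c" "inl d"]) auto
  qed
qed

text \<open>
The union of the two factors contains no product \<open>(b, a)\<close> with \<open>a\<close> and
\<open>b\<close> nontrivial, so a group mapped into it is mapped into one of them.
\<close>
lemma factor_hom_cases:
  assumes \<psi>: "\<psi> \<in> hom G (wreath2 G)"
    and into: "\<And>p. p \<in> carrier G \<Longrightarrow> \<psi> p \<in> inl ` carrier G \<union> inr ` carrier G"
  obtains (left) \<alpha> where "\<alpha> \<in> hom G G" "\<And>p. p \<in> carrier G \<Longrightarrow> \<psi> p = inl (\<alpha> p)"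
    | (right) \<alpha> where "\<alpha> \<in> hom G G" "\<And>p. p \<in> carrier G \<Longrightarrow> \<psi> p = inr (\<alpha> p)"
proof -
  have "(\<forall>p\<in>carrier G. \<psi> p \<in> inl ` carrier G) \<or> (\<forall>p\<in>carrier G. \<psi> p \<in> inr ` carrier G)"
  proof (rule ccontr)
    assume "\<not> ?thesis"
    then obtain p q where pq: "p \<in> carrier G" "q \<in> carrier G"
      "\<psi> p \<notin> inl ` carrier G" "\<psi> q \<notin> inr ` carrier G" by blast
    then obtain a b where ab: "a \<in> carrier G" "b \<in> carrier G" "\<psi> p = inr a" "\<psi> q = inl b"
      using into[of p] into[of q] by blast
    then have "a \<noteq> \<one>" "b \<noteq> \<one>" using pq by auto
    moreover have "\<psi> (p \<otimes> q) = ((b, a), False)"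
      using hom_mult[OF \<psi> pq(1,2)] ab by simp
    ultimately show False using into[of "p \<otimes> q"] pq by auto
  qed
  then show thesis
  proof
    assume l: "\<forall>p\<in>carrier G. \<psi> p \<in> inl ` carrier G"
    have eq: "\<psi> p = inl (fst (fst (\<psi> p))) \<and> fst (fst (\<psi> p)) \<in> carrier G" if "p \<in> carrier G" for p
      using l that by auto
    have "(\<lambda>p. fst (fst (\<psi> p))) \<in> hom G G"
    proof (rule homI)
      fix p q assume pq: "p \<in> carrier G" "q \<in> carrier G"
      have "\<psi> (p \<otimes> q) = inl (fst (fst (\<psi> p))) \<otimes>\<^bsub>wreath2 G\<^esub> inl (fst (fst (\<psi> q)))"
        using hom_mult[OF \<psi> pq] eq[OF pq(1)] eq[OF pq(2)] by simp
      then show "fst (fst (\<psi> (p \<otimes> q))) = fst (fst (\<psi> p)) \<otimes> fst (fst (\<psi> q))"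
        by simp
    qed (use eq in blast)
    then show thesis using eq by (intro left) auto
  next
    assume l: "\<forall>p\<in>carrier G. \<psi> p \<in> inr ` carrier G"
    have eq: "\<psi> p = inr (snd (fst (\<psi> p))) \<and> snd (fst (\<psi> p)) \<in> carrier G" if "p \<in> carrier G" for p
      using l that by auto
    have "(\<lambda>p. snd (fst (\<psi> p))) \<in> hom G G"
    proof (rule homI)
      fix p q assume pq: "p \<in> carrier G" "q \<in> carrier G"
      have "\<psi> (p \<otimes> q) = inr (snd (fst (\<psi> p))) \<otimes>\<^bsub>wreath2 G\<^esub> inr (snd (fst (\<psi> q)))"
        using hom_mult[OF \<psi> pq] eq[OF pq(1)] eq[OF pq(2)] by simp
      then show "snd (fst (\<psi> (p \<otimes> q))) = snd (fst (\<psi> p)) \<otimes> snd (fst (\<psi> q))"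
        by simp
    qed (use eq in blast)
    then show thesis using eq by (intro right) auto
  qed
qed

text \<open>
Endomorphisms, and not only automorphisms, are admitted in the assumption, so that the maps induced
on the factors need not be shown to be bijective.
\<close>
theorem FGFPa_wreath2:
  assumes Fix_fg: "\<And>\<alpha>. \<alpha> \<in> hom G G \<Longrightarrow> fg_subgroup G (Fix G \<alpha>)"
  shows "FGFPa (wreath2 G)"
  unfolding FGFPa_def
proof
  fix \<phi> assume \<phi>: "\<phi> \<in> iso (wreath2 G) (wreath2 G)"
  interpret \<phi>: group_hom "wreath2 G" "wreath2 G" \<phi>
    using \<phi> by unfold_locales (simp add: iso_def)
  have inj: "inj_on \<phi> (carrier (wreath2 G))" using \<phi> by (simp add: iso_def bij_betw_def)
  let ?B = "{x. \<not> snd x} :: (('a \<times> 'a) \<times> bool) set"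
  have sub: "subgroup (Fix (wreath2 G) \<phi>) (wreath2 G)"
    by (rule W.subgroup_Fix[OF \<phi>.homh])
  have into: "\<phi> x \<in> inl ` carrier G \<union> inr ` carrier G" if "x \<in> inl ` carrier G \<union> inr ` carrier G" for x
  proof (cases "x = \<one>\<^bsub>wreath2 G\<^esub>")
    case True
    then show ?thesis using \<phi>.hom_one by (simp add: image_iff)
  next
    case False
    then have "x \<in> wide_elements (wreath2 G)" using that by (simp add: wide_elements_wreath2)
    then have "\<phi> x \<in> wide_elements (wreath2 G)" by (rule wide_elements_iso[OF group_wreath2 \<phi>])
    then show ?thesis by (simp add: wide_elements_wreath2)
  qed
  have hom_l: "(\<lambda>p. \<phi> (inl p)) \<in> hom G (wreath2 G)" and hom_r: "(\<lambda>p. \<phi> (inr p)) \<in> hom G (wreath2 G)"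
    using Group.hom_compose[OF inl_hom \<phi>.homh] Group.hom_compose[OF inr_hom \<phi>.homh] by (simp_all add: comp_def)
  have split: "\<phi> ((p, q), False) = \<phi> (inl p) \<otimes>\<^bsub>wreath2 G\<^esub> \<phi> (inr q)"
    if "p \<in> carrier G" "q \<in> carrier G" for p q
    using \<phi>.hom_mult[of "inl p" "inr q"] that by simp
  \<comment> \<open>The images of the two factors commute and are nonabelian, so they do not fit into one factor.\<close>
  have no_common_factor: False
    if j: "j = inl \<or> j = inr" and "\<alpha> \<in> hom G G" "\<beta> \<in> hom G G"
      and \<alpha>: "\<And>p. p \<in> carrier G \<Longrightarrow> \<phi> (inl p) = j (\<alpha> p)"
      and \<beta>: "\<And>p. p \<in> carrier G \<Longrightarrow> \<phi> (inr p) = j (\<beta> p)" for j \<alpha> \<beta>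
  proof -
    obtain c d where cd: "c \<in> carrier G" "d \<in> carrier G" "(c \<otimes> c) \<otimes> (d \<otimes> d) \<noteq> (d \<otimes> d) \<otimes> (c \<otimes> c)"
      using squares_noncomm by blast
    have closed: "\<alpha> p \<in> carrier G" "\<beta> p \<in> carrier G" if "p \<in> carrier G" for p
      using \<open>\<alpha> \<in> hom G G\<close> \<open>\<beta> \<in> hom G G\<close> that by (auto simp: hom_def)
    have j_mult: "j a \<otimes>\<^bsub>wreath2 G\<^esub> j b = j (a \<otimes> b)" if "a \<in> carrier G" "b \<in> carrier G" for a b
      using j that by auto
    have j_inj: "a = b" if "j a = j b" for a b
      using j that by auto
    have j_one: "j \<one> = \<one>\<^bsub>wreath2 G\<^esub>" using j by auto
    have comm: "\<alpha> p \<otimes> \<beta> q = \<beta> q \<otimes> \<alpha> p" if pq: "p \<in> carrier G" "q \<in> carrier G" for p q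
    proof (rule j_inj)
      have "j (\<alpha> p \<otimes> \<beta> q) = \<phi> (inl p \<otimes>\<^bsub>wreath2 G\<^esub> inr q)"
        using pq closed by (subst \<phi>.hom_mult) (simp_all add: \<alpha> \<beta> j_mult)
      also have "inl p \<otimes>\<^bsub>wreath2 G\<^esub> inr q = inr q \<otimes>\<^bsub>wreath2 G\<^esub> inl p" using pq by simp
      also have "\<phi> \<dots> = j (\<beta> q \<otimes> \<alpha> p)"
        using pq closed by (subst \<phi>.hom_mult) (simp_all add: \<alpha> \<beta> j_mult)
      finally show "j (\<alpha> p \<otimes> \<beta> q) = j (\<beta> q \<otimes> \<alpha> p)" .
    qed
    have "c \<noteq> \<one>" using cd by auto
    have "\<beta> c \<noteq> \<one>"
    proof
      assume "\<beta> c = \<one>"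
      then have "\<phi> (inr c) = \<phi> \<one>\<^bsub>wreath2 G\<^esub>" using \<beta>[OF cd(1)] j_one \<phi>.hom_one by simp
      then show False using inj_onD[OF inj, of "inr c" "\<one>\<^bsub>wreath2 G\<^esub>"] cd(1) \<open>c \<noteq> \<one>\<close> by simp
    qed
    then have \<alpha>cd: "\<alpha> c \<otimes> \<alpha> d = \<alpha> d \<otimes> \<alpha> c"
      using comm closed cd(1,2) by (intro centralizer_comm[of "\<beta> c" "\<alpha> c" "\<alpha> d"]) auto
    have "\<phi> (inl c \<otimes>\<^bsub>wreath2 G\<^esub> inl d) = j (\<alpha> c \<otimes> \<alpha> d)"
      using cd(1,2) closed by (subst \<phi>.hom_mult) (simp_all add: \<alpha> j_mult)
    also have "\<dots> = \<phi> (inl d \<otimes>\<^bsub>wreath2 G\<^esub> inl c)"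
      unfolding \<alpha>cd using cd(1,2) closed by (subst \<phi>.hom_mult) (simp_all add: \<alpha> j_mult)
    finally have cd': "c \<otimes> d = d \<otimes> c"
      using inj_onD[OF inj, of "inl c \<otimes>\<^bsub>wreath2 G\<^esub> inl d" "inl d \<otimes>\<^bsub>wreath2 G\<^esub> inl c"] cd(1,2) by simp
    have "c \<otimes> (d \<otimes> x) = d \<otimes> (c \<otimes> x)" if "x \<in> carrier G" for x
      using cd' cd(1,2) that by (simp add: m_assoc[symmetric])
    then have "(c \<otimes> c) \<otimes> (d \<otimes> d) = (d \<otimes> d) \<otimes> (c \<otimes> c)"
      using cd' cd(1,2) by (simp add: m_assoc)
    then show False using cd(3) by blast
  qed
  \<comment> \<open>The automorphism preserves the two factors, exchanges them, or maps both into the same one.\<close>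
  have "fg_subgroup (wreath2 G) (Fix (wreath2 G) \<phi> \<inter> ?B)"
  proof (rule factor_hom_cases[OF hom_l into]; (rule factor_hom_cases[OF hom_r into])?)
    fix \<alpha> \<beta> assume \<alpha>: "\<alpha> \<in> hom G G" "\<And>p. p \<in> carrier G \<Longrightarrow> \<phi> (inl p) = inl (\<alpha> p)"
      and \<beta>: "\<beta> \<in> hom G G" "\<And>p. p \<in> carrier G \<Longrightarrow> \<phi> (inr p) = inr (\<beta> p)"
    obtain S where S: "finite S" "S \<subseteq> Fix G \<alpha>" "generate G S = Fix G \<alpha>"
      using Fix_fg[OF \<alpha>(1)] unfolding fg_subgroup_def by blast
    obtain T where T: "finite T" "T \<subseteq> Fix G \<beta>" "generate G T = Fix G \<beta>"
      using Fix_fg[OF \<beta>(1)] unfolding fg_subgroup_def by blast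
    have l: "group_hom G (wreath2 G) inl" and r: "group_hom G (wreath2 G) inr"
      by (unfold_locales, rule inl_hom, unfold_locales, rule inr_hom)
    let ?S = "inl ` S \<union> inr ` T"
    have closed: "\<alpha> p \<in> carrier G" "\<beta> p \<in> carrier G" if "p \<in> carrier G" for p
      using \<alpha>(1) \<beta>(1) that by (auto simp: hom_def)
    have eq: "\<phi> ((p, q), False) = ((\<alpha> p, \<beta> q), False)" if "p \<in> carrier G" "q \<in> carrier G" for p q
      unfolding split[OF that] \<alpha>(2)[OF that(1)] \<beta>(2)[OF that(2)]
      using that closed by simp
    have F: "((p, q), False) \<in> Fix (wreath2 G) \<phi> \<longleftrightarrow> p \<in> Fix G \<alpha> \<and> q \<in> Fix G \<beta>" for p q
      by (auto simp: Fix_def eq)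
    have one: "\<one> \<in> Fix G \<alpha>" "\<one> \<in> Fix G \<beta>"
      using F[of \<one> \<one>] subgroup.one_closed[OF sub] by auto
    have "Fix (wreath2 G) \<phi> \<inter> ?B \<subseteq> generate (wreath2 G) ?S"
    proof
      fix x assume x: "x \<in> Fix (wreath2 G) \<phi> \<inter> ?B"
      then obtain p q where pq: "x = ((p, q), False)" by (cases x) auto
      then have pq': "p \<in> Fix G \<alpha>" "q \<in> Fix G \<beta>" using x by (simp_all add: F)
      have "inl p \<in> generate (wreath2 G) (inl ` S)" "inr q \<in> generate (wreath2 G) (inr ` T)"
        using group_hom.generate_img[OF l, of S] group_hom.generate_img[OF r, of T] S T pq' by (auto simp: Fix_def)
      then have "inl p \<otimes>\<^bsub>wreath2 G\<^esub> inr q \<in> generate (wreath2 G) ?S"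
        using W.mono_generate[of "inl ` S" ?S] W.mono_generate[of "inr ` T" ?S]
        by (intro generate.eng) auto
      then show "x \<in> generate (wreath2 G) ?S" using pq pq' by (simp add: Fix_def)
    qed
    moreover have S_sub: "?S \<subseteq> Fix (wreath2 G) \<phi> \<inter> ?B"
    proof (rule Un_least; rule image_subsetI)
      show "inl p \<in> Fix (wreath2 G) \<phi> \<inter> ?B" if "p \<in> S" for p
        using S(2) that by (simp add: F one subset_iff)
      show "inr p \<in> Fix (wreath2 G) \<phi> \<inter> ?B" if "p \<in> T" for p
        using T(2) that by (simp add: F one subset_iff)
    qed
    moreover have "generate (wreath2 G) ?S \<subseteq> Fix (wreath2 G) \<phi> \<inter> ?B"
    proof -
      have "Fix (wreath2 G) \<phi> \<inter> ?B = Fix (wreath2 G) \<phi> \<inter> {x \<in> carrier (wreath2 G). \<not> snd x}"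
        using Fix_carrier[of "wreath2 G" \<phi>] by blast
      then have "subgroup (Fix (wreath2 G) \<phi> \<inter> ?B) (wreath2 G)"
        using W.subgroups_Inter_pair[OF sub subgroup_wreath2_base] by simp
      then show ?thesis by (rule W.generate_subgroup_incl[OF S_sub])
    qed
    ultimately show ?thesis
      using S(1) T(1) unfolding fg_subgroup_def by (intro exI[of _ ?S]) auto
  next
    fix \<alpha> \<beta> assume \<alpha>: "\<alpha> \<in> hom G G" "\<And>p. p \<in> carrier G \<Longrightarrow> \<phi> (inl p) = inr (\<alpha> p)"
      and \<beta>: "\<beta> \<in> hom G G" "\<And>p. p \<in> carrier G \<Longrightarrow> \<phi> (inr p) = inl (\<beta> p)"
    have closed: "\<alpha> p \<in> carrier G" "\<beta> p \<in> carrier G" if "p \<in> carrier G" for p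
      using \<alpha>(1) \<beta>(1) that by (auto simp: hom_def)
    have eq: "\<phi> ((p, q), False) = ((\<beta> q, \<alpha> p), False)" if "p \<in> carrier G" "q \<in> carrier G" for p q
      unfolding split[OF that] \<alpha>(2)[OF that(1)] \<beta>(2)[OF that(2)]
      using that closed by simp
    have F: "((p, q), False) \<in> Fix (wreath2 G) \<phi> \<longleftrightarrow> p \<in> carrier G \<and> \<beta> (\<alpha> p) = p \<and> q = \<alpha> p" for p q
    proof
      assume "((p, q), False) \<in> Fix (wreath2 G) \<phi>"
      then have pq: "p \<in> carrier G" "q \<in> carrier G" "\<phi> ((p, q), False) = ((p, q), False)"
        by (simp_all add: Fix_def)
      have "\<beta> q = p" "\<alpha> p = q" using pq(3) unfolding eq[OF pq(1,2)] by blast+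
      then show "p \<in> carrier G \<and> \<beta> (\<alpha> p) = p \<and> q = \<alpha> p" using pq(1) by simp
    next
      assume "p \<in> carrier G \<and> \<beta> (\<alpha> p) = p \<and> q = \<alpha> p"
      then show "((p, q), False) \<in> Fix (wreath2 G) \<phi>"
        using closed eq[of p q] by (simp add: Fix_def)
    qed
    have "(\<lambda>p. ((p, \<alpha> p), False)) \<in> hom G (wreath2 G)"
      using \<alpha>(1) by (auto intro!: homI simp: hom_def)
    then have \<delta>: "group_hom G (wreath2 G) (\<lambda>p. ((p, \<alpha> p), False))" by unfold_locales
    have "fg_subgroup G (Fix G (\<beta> \<circ> \<alpha>))"
      using Group.hom_compose[OF \<alpha>(1) \<beta>(1)] by (rule Fix_fg)
    then have "fg_subgroup (wreath2 G) ((\<lambda>p. ((p, \<alpha> p), False)) ` Fix G (\<beta> \<circ> \<alpha>))"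
      by (rule group_hom.fg_subgroup_image[OF \<delta> _ Fix_carrier])
    moreover have "(\<lambda>p. ((p, \<alpha> p), False)) ` Fix G (\<beta> \<circ> \<alpha>) = Fix (wreath2 G) \<phi> \<inter> ?B"
    proof
      show "(\<lambda>p. ((p, \<alpha> p), False)) ` Fix G (\<beta> \<circ> \<alpha>) \<subseteq> Fix (wreath2 G) \<phi> \<inter> ?B"
        by (rule image_subsetI) (simp add: F, simp add: Fix_def)
      show "Fix (wreath2 G) \<phi> \<inter> ?B \<subseteq> (\<lambda>p. ((p, \<alpha> p), False)) ` Fix G (\<beta> \<circ> \<alpha>)"
      proof
        fix x assume x: "x \<in> Fix (wreath2 G) \<phi> \<inter> ?B"
        then obtain p q where pq: "x = ((p, q), False)" by (cases x) auto
        then have "p \<in> carrier G" "\<beta> (\<alpha> p) = p" "q = \<alpha> p" using x by (simp_all add: F)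
        then show "x \<in> (\<lambda>p. ((p, \<alpha> p), False)) ` Fix G (\<beta> \<circ> \<alpha>)"
          using pq by (intro image_eqI[of _ _ p]) (simp_all add: Fix_def)
      qed
    qed
    ultimately show ?thesis by simp
  qed (use no_common_factor in blast)+
  then show "fg_subgroup (wreath2 G) (Fix (wreath2 G) \<phi>)"
  proof (rule W.fg_subgroup_index_two[OF sub])
    fix g t assume gt: "g \<in> Fix (wreath2 G) \<phi>" "t \<in> Fix (wreath2 G) \<phi>" "g \<notin> ?B" "t \<notin> ?B"
    then have "g \<in> carrier (wreath2 G)" "t \<in> carrier (wreath2 G)" by (auto simp: Fix_def)
    then show "g \<otimes>\<^bsub>wreath2 G\<^esub> inv\<^bsub>wreath2 G\<^esub> t \<in> ?B"
      using gt(3,4) by (elim wreath2_carrierE) auto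
  qed
qed

end

section \<open>The commutator subgroup of the wreath product\<close>

lemma (in comm_group) commutator_eq_one:
  assumes "x \<in> carrier G" "y \<in> carrier G"
  shows "x \<otimes> y \<otimes> inv x \<otimes> inv y = \<one>"
  using assms by (simp add: m_comm[of x y] m_assoc)

context group
begin

interpretation W: group "wreath2 G" by (rule group_wreath2)

abbreviation comm :: "'a \<Rightarrow> 'a \<Rightarrow> 'a" where
  "comm x y \<equiv> x \<otimes> y \<otimes> inv x \<otimes> inv y"

lemma commutators_mem_normal:
  assumes N: "N \<lhd> G" and z: "z \<in> carrier G" and B: "B \<subseteq> carrier G"
    and comm: "\<And>y. y \<in> B \<Longrightarrow> comm z y \<in> N"
    and p: "p \<in> generate G B"
  shows "comm z p \<in> N"
proof -
  interpret N: normal N G by (rule N)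
  show ?thesis
    using p
  proof (induction rule: generate.induct)
    case one
    then show ?case using z by simp
  next
    case (incl y)
    then show ?case by (rule comm)
  next
    case (inv y)
    then have y: "y \<in> carrier G" using B by blast
    have "inv (comm z y) \<in> N" using comm[OF inv] by simp
    then have "inv y \<otimes> inv (comm z y) \<otimes> y \<in> N"
      using y by (rule N.inv_op_closed1[rotated])
    moreover have "inv y \<otimes> inv (comm z y) \<otimes> y = comm z (inv y)"
      using y z by (simp add: inv_mult_group m_assoc)
    ultimately show ?case by simp
  next
    case (eng p q)
    have pq: "p \<in> carrier G" "q \<in> carrier G"
      using eng.hyps generate_incl[OF B] by blast+
    have "comm z p \<otimes> (p \<otimes> comm z q \<otimes> inv p) \<in> N"
      using eng.IH(1) N.inv_op_closed2[OF pq(1) eng.IH(2)] by (rule N.m_closed)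
    moreover have "comm z p \<otimes> (p \<otimes> comm z q \<otimes> inv p) = comm z (p \<otimes> q)"
      using pq z by (simp add: inv_mult_group m_assoc)
    ultimately show ?case by simp
  qed
qed

text \<open>
The element \<open>(x, x\<^sup>-\<^sup>1)\<close> is the commutator of \<open>(x, \<one>)\<close>
and the swap. The finite set of generators consists of these for \<open>x\<close> a generator of the
group or a product of two generators; let \<open>K\<close> be the subgroup generated by them. The
products of two are included since \<open>(x, x\<^sup>-\<^sup>1) (y, y\<^sup>-\<^sup>1) (x y, (x
y)\<^sup>-\<^sup>1)\<^sup>-\<^sup>1 = (\<one>, x\<^sup>-\<^sup>1 y\<^sup>-\<^sup>1 x y)\<close> puts
commutators of generators into one factor. As \<open>K\<close> projects onto each factor, the
elements \<open>n\<close> with \<open>(\<one>, n)\<close> in \<open>K\<close> form a normal subgroup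
\<open>N\<close>, which therefore contains all commutators. So \<open>K\<close> contains every pair
whose product lies in the commutator subgroup of \<open>G\<close>, and every commutator of the
wreath product is such a pair, by the homomorphism \<open>\<mu>\<close> to the abelianization.
\<close>
theorem fg_derived_wreath2:
  assumes "finite B" and B: "B \<subseteq> carrier G" and gen: "generate G B = carrier G"
  shows "fg_subgroup (wreath2 G) (derived (wreath2 G) (carrier (wreath2 G)))"
proof -
  define anti where "anti p = ((p, inv p), False)" for p
  define C where "C = B \<union> (\<lambda>(x, y). x \<otimes> y) ` (B \<times> B)"
  define K where "K = generate (wreath2 G) (anti ` C)"
  define D where "D = derived G (carrier G)"
  have C: "C \<subseteq> carrier G" using B by (auto simp: C_def)
  have antiC: "anti ` C \<subseteq> carrier (wreath2 G)" using C by (auto simp: anti_def)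
  interpret K: subgroup K "wreath2 G"
    unfolding K_def by (rule W.generate_is_subgroup[OF antiC])
  have anti_derived: "anti p \<in> derived (wreath2 G) (carrier (wreath2 G))" if "p \<in> carrier G" for p
  proof -
    let ?s = "((\<one>, \<one>), True)"
    have "inl p \<otimes>\<^bsub>wreath2 G\<^esub> ?s \<otimes>\<^bsub>wreath2 G\<^esub> inv\<^bsub>wreath2 G\<^esub> (inl p) \<otimes>\<^bsub>wreath2 G\<^esub> inv\<^bsub>wreath2 G\<^esub> ?s
        = anti p"
      using that by (simp add: anti_def)
    then have "anti p \<in> derived_set (wreath2 G) (carrier (wreath2 G))"
      using that by (intro UN_I[of "inl p"] UN_I[of ?s]) auto
    then show ?thesis unfolding derived_def by (rule generate.incl)
  qed
  have K_derived: "K \<subseteq> derived (wreath2 G) (carrier (wreath2 G))"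
    unfolding K_def using anti_derived C
    by (intro W.generate_subgroup_incl W.derived_is_subgroup) auto

  have anti_K: "anti x \<in> K" if "x \<in> C" for x
    unfolding K_def using that by (intro generate.incl) auto
  have proj: "\<exists>p\<in>carrier G. ((p, q), False) \<in> K" if "q \<in> generate G B" for q
    using that
  proof (induction rule: generate.induct)
    case one
    then show ?case using K.one_closed by auto
  next
    case (incl x)
    then have "x \<in> carrier G" "anti x \<in> K" using B anti_K by (auto simp: C_def)
    then show ?case using K.m_inv_closed[of "anti x"] gen by (auto simp: anti_def)
  next
    case (inv x)
    then have "x \<in> carrier G" "anti x \<in> K" using B anti_K by (auto simp: C_def)
    then show ?case using gen by (auto simp: anti_def)
  next
    case (eng q q')
    then obtain p p' where "p \<in> carrier G" "p' \<in> carrier G" "((p, q), False) \<in> K" "((p', q'), False) \<in> K"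
      by blast
    then show ?case using K.m_closed[of "((p, q), False)" "((p', q'), False)"] gen by auto
  qed
  define N where "N = {n \<in> carrier G. inr n \<in> K}"
  have "subgroup N G"
  proof (rule subgroupI)
    show "N \<subseteq> carrier G" by (auto simp: N_def)
    show "N \<noteq> {}" using K.one_closed by (auto simp: N_def)
    show "inv n \<in> N" if "n \<in> N" for n
      using that K.m_inv_closed[of "inr n"] by (simp add: N_def)
    show "m \<otimes> n \<in> N" if "m \<in> N" "n \<in> N" for m n
      using that K.m_closed[of "inr m" "inr n"] by (simp add: N_def)
  qed
  then have N: "N \<lhd> G"
  proof (rule normal_invI)
    fix q n assume q: "q \<in> carrier G" and n: "n \<in> N"
    obtain p where p: "p \<in> carrier G" "((p, q), False) \<in> K" using proj[of q] q gen by blast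
    have "((p, q), False) \<otimes>\<^bsub>wreath2 G\<^esub> inr n \<otimes>\<^bsub>wreath2 G\<^esub> inv\<^bsub>wreath2 G\<^esub> ((p, q), False) \<in> K"
      using p n by (intro K.m_closed K.m_inv_closed) (auto simp: N_def)
    then show "q \<otimes> n \<otimes> inv q \<in> N" using p q n by (simp add: N_def)
  qed
  interpret N: normal N G by (rule N)
  have comm_B: "comm x y \<in> N" if xy: "x \<in> B" "y \<in> B" for x y
  proof -
    have xy': "x \<in> carrier G" "y \<in> carrier G" using xy B by auto
    have "anti x \<otimes>\<^bsub>wreath2 G\<^esub> anti y \<otimes>\<^bsub>wreath2 G\<^esub> inv\<^bsub>wreath2 G\<^esub> (anti (x \<otimes> y)) \<in> K"
      using xy by (intro K.m_closed K.m_inv_closed anti_K) (auto simp: C_def)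
    moreover have "anti x \<otimes>\<^bsub>wreath2 G\<^esub> anti y \<otimes>\<^bsub>wreath2 G\<^esub> inv\<^bsub>wreath2 G\<^esub> (anti (x \<otimes> y))
        = inr (inv x \<otimes> inv y \<otimes> (x \<otimes> y))"
      using xy' by (simp add: anti_def inv_mult_group m_assoc)
    ultimately have "inv x \<otimes> inv y \<otimes> (x \<otimes> y) \<in> N"
      using xy' unfolding N_def by simp
    then have "(y \<otimes> x) \<otimes> (inv x \<otimes> inv y \<otimes> (x \<otimes> y)) \<otimes> inv (y \<otimes> x) \<in> N"
      using xy' by (intro N.inv_op_closed2) auto
    then show ?thesis using xy' by (simp add: inv_mult_group m_assoc)
  qed
  have comm_N: "comm p q \<in> N" if p: "p \<in> carrier G" and q: "q \<in> carrier G" for p q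
  proof (rule commutators_mem_normal[OF N p B])
    fix x assume x: "x \<in> B"
    then have x': "x \<in> carrier G" using B by blast
    have "comm x p \<in> N"
      by (rule commutators_mem_normal[OF N x' B comm_B[OF x]]) (use p gen in auto)
    then have "inv (comm x p) \<in> N" by simp
    then show "comm p x \<in> N" using p x' by (simp add: inv_mult_group m_assoc)
  qed (use q gen in auto)
  have D_N: "D \<subseteq> N"
    unfolding D_def derived_def
    by (rule generate_subgroup_incl[OF _ N.subgroup_axioms]) (use comm_N in auto)
  have anti_all: "anti p \<in> K" if "p \<in> carrier G" for p
    using that unfolding gen[symmetric]
  proof (induction rule: generate.induct)
    case one
    then show ?case using K.one_closed by (simp add: anti_def)
  next
    case (incl x)
    then show ?case using anti_K by (auto simp: C_def)
  next
    case (inv x)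
    then have "x \<in> carrier G" "anti x \<in> K" using B anti_K by (auto simp: C_def)
    then show ?case using K.m_inv_closed[of "anti x"] by (simp add: anti_def)
  next
    case (eng p q)
    then have pq: "p \<in> carrier G" "q \<in> carrier G" by (simp_all add: gen)
    have "inr (comm q p) \<in> K" using comm_N[OF pq(2,1)] unfolding N_def by blast
    then have "anti p \<otimes>\<^bsub>wreath2 G\<^esub> anti q \<otimes>\<^bsub>wreath2 G\<^esub> inr (comm q p) \<in> K"
      using eng.IH by (intro K.m_closed)
    moreover have "anti p \<otimes>\<^bsub>wreath2 G\<^esub> anti q \<otimes>\<^bsub>wreath2 G\<^esub> inr (comm q p) = anti (p \<otimes> q)"
      using pq by (simp add: anti_def inv_mult_group m_assoc)
    ultimately show ?case by (simp only:)
  qed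

  interpret D: normal D G unfolding D_def by (rule derived_self_is_normal)
  interpret Q: comm_group "G Mod D" unfolding D_def by (rule derived_quot_is_comm_group)
  define \<mu> where "\<mu> = (\<lambda>((p, q), b :: bool). D #> (p \<otimes> q))"
  have coset_closed: "D #> p \<in> carrier (G Mod D)" if "p \<in> carrier G" for p
    using hom_in_carrier[OF D.r_coset_hom_Mod that] .
  have coset_mult: "D #> (p \<otimes> q) = (D #> p) \<otimes>\<^bsub>G Mod D\<^esub> (D #> q)"
    if "p \<in> carrier G" "q \<in> carrier G" for p q
    using hom_mult[OF D.r_coset_hom_Mod that] .
  have "\<mu> \<in> hom (wreath2 G) (G Mod D)"
  proof (rule homI)
    fix x assume "x \<in> carrier (wreath2 G)"
    then show "\<mu> x \<in> carrier (G Mod D)"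
      by (elim wreath2_carrierE) (simp add: \<mu>_def coset_closed)
  next
    fix x y assume x: "x \<in> carrier (wreath2 G)" and y: "y \<in> carrier (wreath2 G)"
    obtain p q b where x: "x = ((p, q), b)" "p \<in> carrier G" "q \<in> carrier G"
      using x by (rule wreath2_carrierE)
    obtain p' q' c where y: "y = ((p', q'), c)" "p' \<in> carrier G" "q' \<in> carrier G"
      using y by (rule wreath2_carrierE)
    show "\<mu> (x \<otimes>\<^bsub>wreath2 G\<^esub> y) = \<mu> x \<otimes>\<^bsub>G Mod D\<^esub> \<mu> y"
      using x y by (cases b) (simp_all add: \<mu>_def coset_mult coset_closed Q.m_ac del: mult_FactGroup)
  qed
  then interpret \<mu>: group_hom "wreath2 G" "G Mod D" \<mu> by unfold_locales
  have "derived_set (wreath2 G) (carrier (wreath2 G)) \<subseteq> K"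
  proof
    fix w assume "w \<in> derived_set (wreath2 G) (carrier (wreath2 G))"
    then obtain x y where x: "x \<in> carrier (wreath2 G)" and y: "y \<in> carrier (wreath2 G)"
      and w: "w = x \<otimes>\<^bsub>wreath2 G\<^esub> y \<otimes>\<^bsub>wreath2 G\<^esub> inv\<^bsub>wreath2 G\<^esub> x \<otimes>\<^bsub>wreath2 G\<^esub> inv\<^bsub>wreath2 G\<^esub> y"
      by blast
    have w_carrier: "w \<in> carrier (wreath2 G)"
      unfolding w using x y by (intro W.m_closed W.inv_closed)
    have "\<not> snd w"
    proof -
      obtain a b c where x': "x = ((a, b), c)" "a \<in> carrier G" "b \<in> carrier G"
        using x by (rule wreath2_carrierE)
      obtain a' b' c' where y': "y = ((a', b'), c')" "a' \<in> carrier G" "b' \<in> carrier G"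
        using y by (rule wreath2_carrierE)
      show ?thesis unfolding w x'(1) y'(1) using x' y' by (cases c; cases c') simp_all
    qed
    then obtain u v where uv: "w = ((u, v), False)" "u \<in> carrier G" "v \<in> carrier G"
      using w_carrier by (elim wreath2_carrierE) auto
    have "\<mu> w = \<one>\<^bsub>G Mod D\<^esub>"
    proof -
      have "\<mu> x \<otimes>\<^bsub>G Mod D\<^esub> \<mu> y \<otimes>\<^bsub>G Mod D\<^esub> inv\<^bsub>G Mod D\<^esub> \<mu> x \<otimes>\<^bsub>G Mod D\<^esub> inv\<^bsub>G Mod D\<^esub> \<mu> y = \<one>\<^bsub>G Mod D\<^esub>"
        using \<mu>.hom_closed[OF x] \<mu>.hom_closed[OF y] by (rule Q.commutator_eq_one)
      then show ?thesis using x y unfolding w by (simp only: \<mu>.hom_mult \<mu>.hom_inv W.m_closed W.inv_closed)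
    qed
    then have "D #> (u \<otimes> v) = D" unfolding uv(1) by (simp add: \<mu>_def)
    then have "u \<otimes> v \<in> D" using rcos_self[OF m_closed[OF uv(2,3)] D.subgroup_axioms] by simp
    then have "u \<otimes> v \<in> N" using D_N by blast
    then have "inr (u \<otimes> v) \<in> K" unfolding N_def by blast
    then have "anti u \<otimes>\<^bsub>wreath2 G\<^esub> inr (u \<otimes> v) \<in> K"
      using anti_all[OF uv(2)] by (intro K.m_closed)
    then show "w \<in> K" using uv by (simp add: anti_def)
  qed
  then have "derived (wreath2 G) (carrier (wreath2 G)) \<subseteq> K"
    unfolding derived_def by (rule W.generate_subgroup_incl[OF _ K.subgroup_axioms])
  then have "generate (wreath2 G) (anti ` C) = derived (wreath2 G) (carrier (wreath2 G))"
    using K_derived unfolding K_def by blast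
  moreover have "finite C" using \<open>finite B\<close> by (simp add: C_def)
  moreover have "anti ` C \<subseteq> derived (wreath2 G) (carrier (wreath2 G))"
    using anti_derived C by auto
  ultimately show ?thesis unfolding fg_subgroup_def by (intro exI[of _ "anti ` C"]) auto
qed

end

section \<open>The product with the integers\<close>

context group
begin

theorem not_FGFPa_wreath2_times_integer:
  assumes \<chi>: "\<chi> \<in> hom G integer_group"
    and not_fg: "\<not> fg_subgroup G (kernel G integer_group \<chi>)"
  shows "\<not> FGFPa (wreath2 G \<times>\<times> integer_group)"
proof
  let ?P = "wreath2 G \<times>\<times> integer_group"
  assume fgfp: "FGFPa ?P"
  interpret P: group ?P by (intro DirProd_group group_wreath2 group_integer_group)
  have \<chi>_mult: "\<chi> (p \<otimes> q) = \<chi> p + \<chi> q" if "p \<in> carrier G" "q \<in> carrier G" for p q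
    using hom_mult[OF \<chi> that] by simp
  \<comment> \<open>Conjugation by the swap, twisted by the sum of \<open>\<chi>\<close> over the two factors.\<close>
  define \<psi> where "\<psi> = (\<lambda>(((p, q), b :: bool), n). (((q, p), b), n + \<chi> p + \<chi> q))"
  define \<psi>' where "\<psi>' = (\<lambda>(((p, q), b :: bool), n). (((q, p), b), n - \<chi> p - \<chi> q))"
  have "\<psi> \<in> iso ?P ?P"
    unfolding iso_def
  proof (intro CollectI conjI homI)
    fix x assume "x \<in> carrier ?P"
    then show "\<psi> x \<in> carrier ?P" by (auto simp: \<psi>_def wreath2_def)
  next
    fix x y assume xy: "x \<in> carrier ?P" "y \<in> carrier ?P"
    obtain p q b n where x: "x = (((p, q), b), n)" by (metis prod.exhaust)
    obtain p' q' c m where y: "y = (((p', q'), c), m)" by (metis prod.exhaust)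
    show "\<psi> (x \<otimes>\<^bsub>?P\<^esub> y) = \<psi> x \<otimes>\<^bsub>?P\<^esub> \<psi> y"
      using xy unfolding x y by (cases b) (simp_all add: \<psi>_def \<chi>_mult)
  next
    show "bij_betw \<psi> (carrier ?P) (carrier ?P)"
      by (rule bij_betw_byWitness[of _ \<psi>']) (auto simp: \<psi>_def \<psi>'_def wreath2_def)
  qed
  then have fg: "fg_subgroup ?P (Fix ?P \<psi>)" and \<psi>: "\<psi> \<in> hom ?P ?P"
    using fgfp by (auto simp: FGFPa_def iso_def)
  have sub: "subgroup (Fix ?P \<psi>) ?P" by (rule P.subgroup_Fix[OF \<psi>])
  have Fix_iff: "x \<in> Fix ?P \<psi> \<longleftrightarrow> (\<exists>p b n. x = (((p, p), b), n) \<and> p \<in> kernel G integer_group \<chi>)" for x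
    by (cases x) (auto simp: Fix_def \<psi>_def kernel_def wreath2_def)
  let ?F = "?P\<lparr>carrier := Fix ?P \<psi>\<rparr>"
  \<comment> \<open>Not a homomorphism on the whole product, but on the fixed subgroup, where both components agree.\<close>
  define \<pi> where "\<pi> = (\<lambda>(((p :: 'a, q :: 'a), b :: bool), n :: int). p)"
  have "\<pi> \<in> hom ?F G"
  proof (rule homI)
    fix x assume "x \<in> carrier ?F"
    then show "\<pi> x \<in> carrier G" by (auto simp: Fix_iff \<pi>_def kernel_def)
  next
    fix x y assume "x \<in> carrier ?F" "y \<in> carrier ?F"
    then obtain p b n q c m where x: "x = (((p, p), b), n)" and y: "y = (((q, q), c), m)"
      by (auto simp: Fix_iff)
    show "\<pi> (x \<otimes>\<^bsub>?F\<^esub> y) = \<pi> x \<otimes> \<pi> y"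
      unfolding x y by (cases b) (simp_all add: \<pi>_def)
  qed
  then have \<pi>: "group_hom ?F G \<pi>"
    using P.subgroup_imp_group[OF sub] group_axioms by (simp add: group_hom_def group_hom_axioms_def)
  obtain S where S: "finite S" "S \<subseteq> Fix ?P \<psi>" "generate ?P S = Fix ?P \<psi>"
    using fg unfolding fg_subgroup_def by blast
  have image: "\<pi> ` Fix ?P \<psi> = kernel G integer_group \<chi>"
  proof
    show "\<pi> ` Fix ?P \<psi> \<subseteq> kernel G integer_group \<chi>"
      by (auto simp: Fix_iff \<pi>_def)
    show "kernel G integer_group \<chi> \<subseteq> \<pi> ` Fix ?P \<psi>"
    proof
      fix p assume "p \<in> kernel G integer_group \<chi>"
      then have "(((p, p), False), 0) \<in> Fix ?P \<psi>" unfolding Fix_iff by blast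
      then show "p \<in> \<pi> ` Fix ?P \<psi>" by (rule rev_image_eqI) (simp add: \<pi>_def)
    qed
  qed
  have "generate G (\<pi> ` S) = \<pi> ` generate ?F S"
    using group_hom.generate_img[OF \<pi>, of S] S(2) by simp
  also have "\<dots> = kernel G integer_group \<chi>"
    using P.generate_consistent[OF S(2) sub] S(3) image by simp
  finally have "fg_subgroup G (kernel G integer_group \<chi>)"
    unfolding fg_subgroup_def using S(1,2) image by (intro exI[of _ "\<pi> ` S"]) auto
  then show False using not_fg by simp
qed

end

lemma exists_nat_copy:
  fixes G :: "'a :: countable monoid"
  assumes G: "group G" and fgfp: "FGFPa G"
    and derived: "fg_subgroup G (derived G (carrier G))"
    and prod: "\<not> FGFPa (G \<times>\<times> integer_group)"
  shows "\<exists>H :: nat monoid. group H \<and> FGFPa H \<and>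
           fg_subgroup H (derived H (carrier H)) \<and>
           \<not> FGFPa (H \<times>\<times> integer_group)"
proof -
  interpret G: group G by (rule G)
  define H where "H = image_group (to_nat :: 'a \<Rightarrow> nat) G"
  have inj: "inj_on (to_nat :: 'a \<Rightarrow> nat) (carrier G)" by simp
  have H: "group H" and iso: "to_nat \<in> iso G H"
    unfolding H_def
    using G.inj_imp_image_group_is_group[OF inj] inj_imp_image_group_iso[OF inj] by auto
  interpret h: group_hom G H to_nat
    using G H iso by (simp add: group_hom_def group_hom_axioms_def iso_def)
  have "FGFPa H" by (rule FGFPa_iso[OF G H iso fgfp])
  moreover have "fg_subgroup H (derived H (carrier H))"
  proof -
    have "to_nat ` carrier G = carrier H" using iso by (simp add: iso_def bij_betw_def)
    then have "derived H (carrier H) = to_nat ` derived G (carrier G)"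
      using h.derived_img[of "carrier G"] by simp
    then show ?thesis
      using h.fg_subgroup_image[OF derived] G.derived_in_carrier[of "carrier G"] by simp
  qed
  moreover have "\<not> FGFPa (H \<times>\<times> integer_group)"
  proof
    assume "FGFPa (H \<times>\<times> integer_group)"
    moreover have "(\<lambda>(x, y). (to_nat x, y)) \<in> iso (G \<times>\<times> integer_group) (H \<times>\<times> integer_group)"
      using G.DirProd_iso_set_trans[OF iso iso_set_refl, of integer_group] by simp
    then have "inv_into (carrier (G \<times>\<times> integer_group)) (\<lambda>(x, y). (to_nat x, y))
        \<in> iso (H \<times>\<times> integer_group) (G \<times>\<times> integer_group)"
      by (rule group.iso_set_sym[OF DirProd_group[OF G group_integer_group]])
    ultimately have "FGFPa (G \<times>\<times> integer_group)"
      by (intro FGFPa_iso[OF DirProd_group[OF H group_integer_group] DirProd_group[OF G group_integer_group]])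
    then show False using prod by simp
  qed
  ultimately show ?thesis using H by blast
qed

section \<open>Sanov's free group\<close>

text \<open>
The matrices with rows \<open>(p, q)\<close> and \<open>(r, s)\<close> that are generated freely by
the two elementary matrices with off-diagonal entry \<open>2\<close>. The diagonal is congruent to
\<open>1\<close> modulo \<open>4\<close>, and not merely odd, in order to exclude \<open>-1\<close>,
which is central of order two.
\<close>
definition sanov :: "(int \<times> int \<times> int \<times> int) monoid" where
  "sanov = \<lparr>carrier = {(p, q, r, s). p * s - q * r = 1 \<and> 4 dvd p - 1 \<and> 4 dvd s - 1 \<and> 2 dvd q \<and> 2 dvd r},
     monoid.mult = (\<lambda>(p, q, r, s) (p', q', r', s').
       (p * p' + q * r', p * q' + q * s', r * p' + s * r', r * q' + s * s')),
     monoid.one = (1, 0, 0, 1)\<rparr>"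

lemma sanov_simps [simp]:
  "(p, q, r, s) \<in> carrier sanov \<longleftrightarrow>
     p * s - q * r = 1 \<and> 4 dvd p - 1 \<and> 4 dvd s - 1 \<and> 2 dvd q \<and> 2 dvd r"
  "(p, q, r, s) \<otimes>\<^bsub>sanov\<^esub> (p', q', r', s') =
     (p * p' + q * r', p * q' + q * s', r * p' + s * r', r * q' + s * s')"
  "\<one>\<^bsub>sanov\<^esub> = (1, 0, 0, 1)"
  by (simp_all add: sanov_def)

lemma sanov_mult_closed:
  assumes "(p, q, r, s) \<in> carrier sanov" "(p', q', r', s') \<in> carrier sanov"
  shows "(p, q, r, s) \<otimes>\<^bsub>sanov\<^esub> (p', q', r', s') \<in> carrier sanov"
proof -
  have g: "p * s - q * r = 1" "4 dvd p - 1" "4 dvd s - 1" "2 dvd q" "2 dvd r"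
    and h: "p' * s' - q' * r' = 1" "4 dvd p' - 1" "4 dvd s' - 1" "2 dvd q'" "2 dvd r'"
    using assms by auto
  have det: "(p * p' + q * r') * (r * q' + s * s') - (p * q' + q * s') * (r * p' + s * r') =
      (p * s - q * r) * (p' * s' - q' * r')"
    by (simp add: algebra_simps)
  have "4 dvd q * r'" "4 dvd r * q'"
    using mult_dvd_mono[OF g(4) h(5)] mult_dvd_mono[OF g(5) h(4)] by simp_all
  then have "4 dvd (p - 1) * p' + (p' - 1) + q * r'" "4 dvd (s - 1) * s' + (s' - 1) + r * q'"
    using g h by (auto intro!: dvd_add)
  moreover have "(p - 1) * p' + (p' - 1) + q * r' = p * p' + q * r' - 1"
    "(s - 1) * s' + (s' - 1) + r * q' = r * q' + s * s' - 1"
    by (simp_all add: algebra_simps)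
  ultimately show ?thesis using det g h by simp
qed

lemma group_sanov: "group sanov"
proof (rule groupI)
  show "x \<otimes>\<^bsub>sanov\<^esub> y \<in> carrier sanov" if "x \<in> carrier sanov" "y \<in> carrier sanov" for x y
    using that sanov_mult_closed by (cases x; cases y) blast
  show "x \<otimes>\<^bsub>sanov\<^esub> y \<otimes>\<^bsub>sanov\<^esub> z = x \<otimes>\<^bsub>sanov\<^esub> (y \<otimes>\<^bsub>sanov\<^esub> z)" for x y z
    by (cases x; cases y; cases z) (simp add: algebra_simps)
  show "\<one>\<^bsub>sanov\<^esub> \<otimes>\<^bsub>sanov\<^esub> x = x" for x by (cases x) simp
  show "\<exists>y\<in>carrier sanov. y \<otimes>\<^bsub>sanov\<^esub> x = \<one>\<^bsub>sanov\<^esub>" if "x \<in> carrier sanov" for x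
  proof -
    obtain p q r s where x: "x = (p, q, r, s)" by (cases x)
    show ?thesis using that
      by (intro bexI[of _ "(s, -q, -r, p)"]) (auto simp: x algebra_simps)
  qed
qed simp

interpretation sanov: group sanov by (rule group_sanov)

lemma inv_sanov [simp]:
  assumes "(p, q, r, s) \<in> carrier sanov"
  shows "inv\<^bsub>sanov\<^esub> (p, q, r, s) = (s, -q, -r, p)"
  using assms by (intro sanov.inv_equality) (auto simp: algebra_simps)

text \<open>
The Gram matrix of the rows. Adding twice a row to the other one shortens or lengthens it according
to how \<open>gram12\<close> compares with the squared lengths \<open>gram11\<close> and
\<open>gram22\<close>, and this determines the first letter of a reduced word, as in the reduction
of binary quadratic forms.
\<close>
fun gram11 :: "int \<times> int \<times> int \<times> int \<Rightarrow> int" where "gram11 (p, q, r, s) = p\<^sup>2 + q\<^sup>2"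
fun gram22 :: "int \<times> int \<times> int \<times> int \<Rightarrow> int" where "gram22 (p, q, r, s) = r\<^sup>2 + s\<^sup>2"
fun gram12 :: "int \<times> int \<times> int \<times> int \<Rightarrow> int" where "gram12 (p, q, r, s) = p * r + q * s"

lemma sanov_form:
  assumes "g \<in> carrier sanov"
  shows "gram11 g * gram22 g = (gram12 g)\<^sup>2 + 1" "even (gram12 g)" "odd (gram11 g)" "odd (gram22 g)"
    "gram11 g > 0" "gram22 g > 0"
proof -
  obtain p q r s where g: "g = (p, q, r, s)" by (cases g)
  have h: "p * s - q * r = 1" "4 dvd p - 1" "4 dvd s - 1" "even q" "even r"
    using assms by (simp_all add: g)
  have odd: "odd p" "odd s" using h(2,3) by presburger+
  have "gram11 g * gram22 g = (gram12 g)\<^sup>2 + (p * s - q * r)\<^sup>2"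
    by (simp add: g power2_eq_square algebra_simps)
  then show "gram11 g * gram22 g = (gram12 g)\<^sup>2 + 1" by (simp add: h)
  show "even (gram12 g)" "odd (gram11 g)" "odd (gram22 g)" using h odd by (simp_all add: g)
  have "p \<noteq> 0" "s \<noteq> 0" using odd by auto
  then show "gram11 g > 0" "gram22 g > 0"
    by (simp_all add: g add_pos_nonneg add_nonneg_pos)
qed

text \<open>
The determinant is \<open>1\<close>, so \<open>gram12\<close> cannot exceed both squared lengths in
absolute value, and by \<open>sanov_dominant\<close> it is bounded by both of them only for the
identity.
\<close>
lemma sanov_not_both:
  assumes "g \<in> carrier sanov"
  shows "\<bar>gram12 g\<bar> \<le> gram22 g \<or> \<bar>gram12 g\<bar> \<le> gram11 g"
proof (rule ccontr)
  assume "\<not> ?thesis"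
  then have "gram11 g * gram22 g \<le> \<bar>gram12 g\<bar> * \<bar>gram12 g\<bar>"
    using sanov_form(5,6)[OF assms] by (intro mult_mono) auto
  then show False using sanov_form(1)[OF assms] by (simp add: power2_eq_square)
qed

lemma sanov_dominant:
  assumes g: "g \<in> carrier sanov" "g \<noteq> \<one>\<^bsub>sanov\<^esub>"
  shows "gram22 g < \<bar>gram12 g\<bar> \<or> gram11 g < \<bar>gram12 g\<bar>"
proof (rule ccontr)
  assume neg: "\<not> ?thesis"
  note form = sanov_form[OF g(1)]
  have "gram22 g \<noteq> \<bar>gram12 g\<bar>" "gram11 g \<noteq> \<bar>gram12 g\<bar>" using form(2,3,4) by auto
  then have "gram22 g \<ge> \<bar>gram12 g\<bar> + 1" "gram11 g \<ge> \<bar>gram12 g\<bar> + 1" using neg by auto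
  then have "gram11 g * gram22 g \<ge> (\<bar>gram12 g\<bar> + 1) * (\<bar>gram12 g\<bar> + 1)" by (intro mult_mono) auto
  then have "gram12 g = 0" using form(1) by (simp add: power2_eq_square algebra_simps)
  then have "gram11 g * gram22 g = 1" using form(1) by simp
  then have one: "gram11 g = 1" "gram22 g = 1" using form(5,6) by (auto simp: zmult_eq_1_iff)
  obtain p q r s where g': "g = (p, q, r, s)" by (cases g)
  have h: "p * s - q * r = 1" "4 dvd p - 1" "4 dvd s - 1" "even q" "even r"
    using g by (simp_all add: g')
  have unit: "x = 0 \<and> (y = 1 \<or> y = -1)" if "x\<^sup>2 + y\<^sup>2 = 1" "even x" for x y :: int
  proof -
    have "x = 0"
    proof (rule ccontr)
      assume "x \<noteq> 0"
      then have "\<bar>x\<bar> \<ge> 2" using \<open>even x\<close> by (auto elim!: evenE)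
      then have "x\<^sup>2 \<ge> 2\<^sup>2" by (metis abs_le_square_iff abs_numeral)
      then show False using that(1) zero_le_power2[of y] by simp
    qed
    then show ?thesis using that(1) by (simp add: power2_eq_1_iff)
  qed
  have "q = 0 \<and> (p = 1 \<or> p = -1)" "r = 0 \<and> (s = 1 \<or> s = -1)"
    using unit[of q p] unit[of r s] one h by (simp_all add: g' add.commute)
  then have "g = \<one>\<^bsub>sanov\<^esub>" using h by (auto simp: g')
  then show False using g(2) by simp
qed

abbreviation (input) La :: "int \<times> int \<times> int \<times> int" where "La \<equiv> (1, 2, 0, 1)"
abbreviation (input) La' :: "int \<times> int \<times> int \<times> int" where "La' \<equiv> (1, -2, 0, 1)"
abbreviation (input) Lb :: "int \<times> int \<times> int \<times> int" where "Lb \<equiv> (1, 0, 2, 1)"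
abbreviation (input) Lb' :: "int \<times> int \<times> int \<times> int" where "Lb' \<equiv> (1, 0, -2, 1)"

definition sanov_first :: "int \<times> int \<times> int \<times> int \<Rightarrow> int \<times> int \<times> int \<times> int" where
  "sanov_first g = (if g = \<one>\<^bsub>sanov\<^esub> then \<one>\<^bsub>sanov\<^esub>
     else if gram22 g < gram12 g then La else if gram22 g < - gram12 g then La'
     else if gram11 g < gram12 g then Lb else Lb')"

lemma form_La: "gram11 (La \<otimes>\<^bsub>sanov\<^esub> g) = gram11 g + 4 * gram12 g + 4 * gram22 g"
    "gram12 (La \<otimes>\<^bsub>sanov\<^esub> g) = gram12 g + 2 * gram22 g" "gram22 (La \<otimes>\<^bsub>sanov\<^esub> g) = gram22 g"
  and form_La': "gram11 (La' \<otimes>\<^bsub>sanov\<^esub> g) = gram11 g - 4 * gram12 g + 4 * gram22 g"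
    "gram12 (La' \<otimes>\<^bsub>sanov\<^esub> g) = gram12 g - 2 * gram22 g" "gram22 (La' \<otimes>\<^bsub>sanov\<^esub> g) = gram22 g"
  and form_Lb: "gram11 (Lb \<otimes>\<^bsub>sanov\<^esub> g) = gram11 g"
    "gram12 (Lb \<otimes>\<^bsub>sanov\<^esub> g) = gram12 g + 2 * gram11 g" "gram22 (Lb \<otimes>\<^bsub>sanov\<^esub> g) = gram22 g + 4 * gram12 g + 4 * gram11 g"
  and form_Lb': "gram11 (Lb' \<otimes>\<^bsub>sanov\<^esub> g) = gram11 g"
    "gram12 (Lb' \<otimes>\<^bsub>sanov\<^esub> g) = gram12 g - 2 * gram11 g" "gram22 (Lb' \<otimes>\<^bsub>sanov\<^esub> g) = gram22 g - 4 * gram12 g + 4 * gram11 g"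
  by (cases g; simp add: power2_eq_square algebra_simps)+

lemmas form_letters = form_La form_La' form_Lb form_Lb'

definition letters :: "(int \<times> int \<times> int \<times> int) set" where
  "letters = {La, La', Lb, Lb'}"

text \<open>
Unless it cancels, a letter lengthens the row that it changes so much that its inverse is what
shortens this row again. The parity of the Gram matrix turns the weak inequality that the definition
of \<open>sanov_first\<close> provides into the strict one required.
\<close>
lemma sanov_first_mult:
  assumes x: "x \<in> letters" and g: "g \<in> carrier sanov" and ne: "sanov_first g \<noteq> inv\<^bsub>sanov\<^esub> x"
  shows "sanov_first (x \<otimes>\<^bsub>sanov\<^esub> g) = x"
proof -
  have xc: "x \<in> carrier sanov" using x by (auto simp: letters_def)
  have xg: "x \<otimes>\<^bsub>sanov\<^esub> g \<in> carrier sanov" using xc g by simp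
  note form = sanov_form[OF g]
  have par: "gram22 g \<noteq> gram12 g" "gram22 g \<noteq> - gram12 g" "gram11 g \<noteq> gram12 g" "gram11 g \<noteq> - gram12 g"
    using form(2,3,4) by auto
  have one: "gram22 \<one>\<^bsub>sanov\<^esub> = 1" "gram11 \<one>\<^bsub>sanov\<^esub> = 1" "gram12 \<one>\<^bsub>sanov\<^esub> = 0" by simp_all
  note both = sanov_not_both[OF g] sanov_not_both[OF xg]
  consider "x = La" | "x = La'" | "x = Lb" | "x = Lb'" using x by (auto simp: letters_def)
  then show ?thesis
  proof cases
    case 1
    then have "sanov_first g \<noteq> La'" using ne by simp
    then have "gram12 g > - gram22 g"
      using par form one by (auto simp: sanov_first_def split: if_splits)
    then have "gram22 (x \<otimes>\<^bsub>sanov\<^esub> g) < gram12 (x \<otimes>\<^bsub>sanov\<^esub> g)" using 1 by (simp only: form_letters)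
    moreover from this have "x \<otimes>\<^bsub>sanov\<^esub> g \<noteq> \<one>\<^bsub>sanov\<^esub>" using one by auto
    ultimately show ?thesis unfolding sanov_first_def 1 by (simp del: sanov_simps)
  next
    case 2
    then have "sanov_first g \<noteq> La" using ne by simp
    then have "gram12 g < gram22 g"
      using par form one by (auto simp: sanov_first_def split: if_splits)
    then have "gram22 (x \<otimes>\<^bsub>sanov\<^esub> g) < - gram12 (x \<otimes>\<^bsub>sanov\<^esub> g)" using 2 by (simp only: form_letters)
    moreover from this have "x \<otimes>\<^bsub>sanov\<^esub> g \<noteq> \<one>\<^bsub>sanov\<^esub>" "\<not> gram22 (x \<otimes>\<^bsub>sanov\<^esub> g) < gram12 (x \<otimes>\<^bsub>sanov\<^esub> g)"
      using one sanov_form(6)[OF xg] by auto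
    ultimately show ?thesis unfolding sanov_first_def 2 by (simp del: sanov_simps)
  next
    case 3
    then have "sanov_first g \<noteq> Lb'" using ne by simp
    then have "gram12 g > - gram11 g"
      using par form one both(1) by (auto simp: sanov_first_def split: if_splits)
    then have "gram11 (x \<otimes>\<^bsub>sanov\<^esub> g) < gram12 (x \<otimes>\<^bsub>sanov\<^esub> g)" using 3 by (simp only: form_letters)
    moreover from this have "x \<otimes>\<^bsub>sanov\<^esub> g \<noteq> \<one>\<^bsub>sanov\<^esub>" "\<not> gram22 (x \<otimes>\<^bsub>sanov\<^esub> g) < gram12 (x \<otimes>\<^bsub>sanov\<^esub> g)"
      "\<not> gram22 (x \<otimes>\<^bsub>sanov\<^esub> g) < - gram12 (x \<otimes>\<^bsub>sanov\<^esub> g)"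
      using one both(2) by (auto simp: abs_le_iff)
    ultimately show ?thesis unfolding sanov_first_def 3 by (simp del: sanov_simps)
  next
    case 4
    then have "sanov_first g \<noteq> Lb" using ne by simp
    then have "gram12 g < gram11 g"
      using par form one both(1) by (auto simp: sanov_first_def split: if_splits)
    then have "gram11 (x \<otimes>\<^bsub>sanov\<^esub> g) < - gram12 (x \<otimes>\<^bsub>sanov\<^esub> g)" using 4 by (simp only: form_letters)
    moreover from this have "x \<otimes>\<^bsub>sanov\<^esub> g \<noteq> \<one>\<^bsub>sanov\<^esub>" "\<not> gram22 (x \<otimes>\<^bsub>sanov\<^esub> g) < gram12 (x \<otimes>\<^bsub>sanov\<^esub> g)"
      "\<not> gram22 (x \<otimes>\<^bsub>sanov\<^esub> g) < - gram12 (x \<otimes>\<^bsub>sanov\<^esub> g)"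
      "\<not> gram11 (x \<otimes>\<^bsub>sanov\<^esub> g) < gram12 (x \<otimes>\<^bsub>sanov\<^esub> g)"
      using one both(2) sanov_form(5)[OF xg] by (auto simp: abs_le_iff)
    ultimately show ?thesis unfolding sanov_first_def 4 by (simp del: sanov_simps)
  qed
qed

lemma sanov_descent:
  assumes g: "g \<in> carrier sanov" "g \<noteq> \<one>\<^bsub>sanov\<^esub>"
  shows "nat (gram11 (inv\<^bsub>sanov\<^esub> (sanov_first g) \<otimes>\<^bsub>sanov\<^esub> g) + gram22 (inv\<^bsub>sanov\<^esub> (sanov_first g) \<otimes>\<^bsub>sanov\<^esub> g))
    < nat (gram11 g + gram22 g)"
proof -
  note form = sanov_form[OF g(1)]
  have pos: "0 < gram11 g + gram22 g" using form by simp
  consider "sanov_first g = La" "gram22 g < gram12 g" | "sanov_first g = La'" "gram22 g < - gram12 g"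
    | "sanov_first g = Lb" "gram11 g < gram12 g" | "sanov_first g = Lb'" "gram11 g < - gram12 g"
  proof -
    consider "gram22 g < gram12 g" | "\<not> gram22 g < gram12 g" "gram22 g < - gram12 g"
      | "\<not> gram22 g < gram12 g" "\<not> gram22 g < - gram12 g" "gram11 g < gram12 g"
      | "\<not> gram22 g < gram12 g" "\<not> gram22 g < - gram12 g" "\<not> gram11 g < gram12 g" "gram11 g < - gram12 g"
      using sanov_dominant[OF g] by linarith
    then show thesis
      by cases (use that g(2) in \<open>simp_all add: sanov_first_def\<close>)
  qed
  then show ?thesis
  proof cases
    case 1
    have "inv\<^bsub>sanov\<^esub> (sanov_first g) = La'" unfolding 1(1) by simp
    then show ?thesis using 1(2) pos by (simp add: form_letters)
  next
    case 2
    have "inv\<^bsub>sanov\<^esub> (sanov_first g) = La" unfolding 2(1) by simp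
    then show ?thesis using 2(2) pos by (simp add: form_letters)
  next
    case 3
    have "inv\<^bsub>sanov\<^esub> (sanov_first g) = Lb'" unfolding 3(1) by simp
    then show ?thesis using 3(2) pos by (simp add: form_letters)
  next
    case 4
    have "inv\<^bsub>sanov\<^esub> (sanov_first g) = Lb" unfolding 4(1) by simp
    then show ?thesis using 4(2) pos by (simp add: form_letters)
  qed
qed

lemma first_letter_group_sanov:
  "first_letter_group sanov letters sanov_first (\<lambda>g. nat (gram11 g + gram22 g))"
proof (rule first_letter_group.intro[OF group_sanov], rule first_letter_group_axioms.intro)
  show "x \<in> letters \<Longrightarrow> inv\<^bsub>sanov\<^esub> x \<in> letters" for x by (auto simp: letters_def)
  show "sanov_first g \<in> letters" if "g \<noteq> \<one>\<^bsub>sanov\<^esub>" for g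
    using that by (simp add: sanov_first_def letters_def)
  show "finite letters" "letters \<subseteq> carrier sanov" "\<one>\<^bsub>sanov\<^esub> \<notin> letters"
    by (simp_all add: letters_def)
  show "sanov_first \<one>\<^bsub>sanov\<^esub> = \<one>\<^bsub>sanov\<^esub>" unfolding sanov_first_def by (rule if_P) (rule refl)
qed (rule sanov_first_mult sanov_descent; assumption)+

interpretation sanov: first_letter_group sanov letters sanov_first "\<lambda>g. nat (gram11 g + gram22 g)"
  by (rule first_letter_group_sanov)

text \<open>
Two matrices commute if and only if their vectors \<open>(q, r, p - s)\<close> are parallel, and for
\<open>x\<close> this vector is nonzero because the only scalar matrix in the group is the identity.
\<close>
lemma sanov_centralizer_comm:
  assumes "x \<in> carrier sanov" "x \<noteq> \<one>\<^bsub>sanov\<^esub>"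
    and "x \<otimes>\<^bsub>sanov\<^esub> y = y \<otimes>\<^bsub>sanov\<^esub> x" "x \<otimes>\<^bsub>sanov\<^esub> z = z \<otimes>\<^bsub>sanov\<^esub> x"
  shows "y \<otimes>\<^bsub>sanov\<^esub> z = z \<otimes>\<^bsub>sanov\<^esub> y"
proof -
  obtain p q r s where x: "x = (p, q, r, s)" by (cases x)
  obtain p1 q1 r1 s1 where y: "y = (p1, q1, r1, s1)" by (cases y)
  obtain p2 q2 r2 s2 where z: "z = (p2, q2, r2, s2)" by (cases z)
  have parallel1: "q * r1 = q1 * r" "q * (p1 - s1) = q1 * (p - s)" "r * (p1 - s1) = r1 * (p - s)"
  proof -
    have "p * p1 + q * r1 = p1 * p + q1 * r" "p * q1 + q * s1 = p1 * q + q1 * s"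
      "r * p1 + s * r1 = r1 * p + s1 * r"
      using assms(3) by (simp_all add: x y)
    moreover have "q * r1 - q1 * r = (p * p1 + q * r1) - (p1 * p + q1 * r)"
      "q * (p1 - s1) - q1 * (p - s) = (p1 * q + q1 * s) - (p * q1 + q * s1)"
      "r * (p1 - s1) - r1 * (p - s) = (r * p1 + s * r1) - (r1 * p + s1 * r)"
      by (simp_all add: algebra_simps)
    ultimately show "q * r1 = q1 * r" "q * (p1 - s1) = q1 * (p - s)" "r * (p1 - s1) = r1 * (p - s)"
      by linarith+
  qed
  have parallel2: "q * r2 = q2 * r" "q * (p2 - s2) = q2 * (p - s)" "r * (p2 - s2) = r2 * (p - s)"
  proof -
    have "p * p2 + q * r2 = p2 * p + q2 * r" "p * q2 + q * s2 = p2 * q + q2 * s"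
      "r * p2 + s * r2 = r2 * p + s2 * r"
      using assms(4) by (simp_all add: x z)
    moreover have "q * r2 - q2 * r = (p * p2 + q * r2) - (p2 * p + q2 * r)"
      "q * (p2 - s2) - q2 * (p - s) = (p2 * q + q2 * s) - (p * q2 + q * s2)"
      "r * (p2 - s2) - r2 * (p - s) = (r * p2 + s * r2) - (r2 * p + s2 * r)"
      by (simp_all add: algebra_simps)
    ultimately show "q * r2 = q2 * r" "q * (p2 - s2) = q2 * (p - s)" "r * (p2 - s2) = r2 * (p - s)"
      by linarith+
  qed
  have cross: "a1 * b2 = a2 * b1"
    if "q * a1 = q1 * a" "q * a2 = q2 * a" "q * b1 = q1 * b" "q * b2 = q2 * b" "q \<noteq> 0"
    for a a1 a2 b b1 b2 q q1 q2 :: int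
  proof -
    have "q\<^sup>2 * (a1 * b2) = (q * a1) * (q * b2)" "q\<^sup>2 * (a2 * b1) = (q * a2) * (q * b1)"
      by (simp_all add: power2_eq_square algebra_simps)
    then have "q\<^sup>2 * (a1 * b2) = q\<^sup>2 * (a2 * b1)" using that(1-4) by simp
    then show ?thesis using that(5) by simp
  qed
  have "q \<noteq> 0 \<or> r \<noteq> 0 \<or> p \<noteq> s"
  proof (rule ccontr)
    assume "\<not> ?thesis"
    then have "p * p = 1" "4 dvd p - 1" "q = 0" "r = 0" "p = s" using assms(1) by (auto simp: x)
    moreover from this have "p = 1" by (auto simp: zmult_eq_1_iff)
    ultimately show False using assms(2) by (simp add: x)
  qed
  then have "q1 * r2 = q2 * r1 \<and> q1 * (p2 - s2) = q2 * (p1 - s1) \<and> r1 * (p2 - s2) = r2 * (p1 - s1)"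
  proof (elim disjE)
    assume "q \<noteq> 0"
    then show ?thesis
      using cross[of q q1 q1 q q2 q2 r1 r r2] cross[of q q1 q1 q q2 q2 "p1 - s1" "p - s" "p2 - s2"]
        cross[of q r1 q1 r r2 q2 "p1 - s1" "p - s" "p2 - s2"] parallel1 parallel2
      by (simp add: mult.commute)
  next
    assume "r \<noteq> 0"
    then show ?thesis
      using cross[of r q1 r1 q q2 r2 r1 r r2] cross[of r q1 r1 q q2 r2 "p1 - s1" "p - s" "p2 - s2"]
        cross[of r r1 r1 r r2 r2 "p1 - s1" "p - s" "p2 - s2"] parallel1 parallel2
      by (simp add: mult.commute)
  next
    assume "p \<noteq> s"
    then show ?thesis
      using cross[of "p - s" q1 "p1 - s1" q q2 "p2 - s2" r1 r r2]
        cross[of "p - s" q1 "p1 - s1" q q2 "p2 - s2" "p1 - s1" "p - s" "p2 - s2"]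
        cross[of "p - s" r1 "p1 - s1" r r2 "p2 - s2" "p1 - s1" "p - s" "p2 - s2"] parallel1 parallel2
      by (simp add: mult.commute)
  qed
  moreover have "p1 * p2 + q1 * r2 - (p2 * p1 + q2 * r1) = q1 * r2 - q2 * r1"
    "p2 * q1 + q2 * s1 - (p1 * q2 + q1 * s2) = q1 * (p2 - s2) - q2 * (p1 - s1)"
    "r1 * p2 + s1 * r2 - (r2 * p1 + s2 * r1) = r1 * (p2 - s2) - r2 * (p1 - s1)"
    "r1 * q2 + s1 * s2 - (r2 * q1 + s2 * s1) = q2 * r1 - q1 * r2"
    by (simp_all add: algebra_simps)
  ultimately have "p1 * p2 + q1 * r2 = p2 * p1 + q2 * r1" "p1 * q2 + q1 * s2 = p2 * q1 + q2 * s1"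
    "r1 * p2 + s1 * r2 = r2 * p1 + s2 * r1" "r1 * q2 + s1 * s2 = r2 * q1 + s2 * s1"
    by linarith+
  then show ?thesis by (simp add: y z)
qed

lemma sanov_no_involution:
  assumes x: "x \<in> carrier sanov" "x \<otimes>\<^bsub>sanov\<^esub> x = \<one>\<^bsub>sanov\<^esub>"
  shows "x = \<one>\<^bsub>sanov\<^esub>"
proof -
  obtain p q r s where x': "x = (p, q, r, s)" by (cases x)
  have h: "p * s - q * r = 1" "4 dvd p - 1" "4 dvd s - 1"
    and sq: "p * p + q * r = 1" "p * q + q * s = 0" "r * p + s * r = 0"
    using x by (simp_all add: x')
  have "p + s \<noteq> 0" using h(2,3) by presburger
  moreover have "q * (p + s) = 0" "r * (p + s) = 0" using sq by (simp_all add: algebra_simps)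
  ultimately have "q = 0" "r = 0" by simp_all
  moreover from this have "p = 1 \<or> p = -1" using sq(1) by (auto simp: zmult_eq_1_iff)
  ultimately show ?thesis using h by (auto simp: x')
qed

lemma thin_centralizer_group_sanov: "thin_centralizer_group sanov"
proof (rule thin_centralizer_group.intro[OF group_sanov], rule thin_centralizer_group_axioms.intro)
  show "y \<otimes>\<^bsub>sanov\<^esub> z = z \<otimes>\<^bsub>sanov\<^esub> y"
    if "x \<in> carrier sanov" "x \<noteq> \<one>\<^bsub>sanov\<^esub>" "x \<otimes>\<^bsub>sanov\<^esub> y = y \<otimes>\<^bsub>sanov\<^esub> x"
      "x \<otimes>\<^bsub>sanov\<^esub> z = z \<otimes>\<^bsub>sanov\<^esub> x" for x y z
    using sanov_centralizer_comm that .
  show "x = \<one>\<^bsub>sanov\<^esub>" if "x \<in> carrier sanov" "x \<otimes>\<^bsub>sanov\<^esub> x = \<one>\<^bsub>sanov\<^esub>" for x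
    using sanov_no_involution that .
  show "\<exists>c\<in>carrier sanov. \<exists>d\<in>carrier sanov.
      (c \<otimes>\<^bsub>sanov\<^esub> c) \<otimes>\<^bsub>sanov\<^esub> (d \<otimes>\<^bsub>sanov\<^esub> d) \<noteq> (d \<otimes>\<^bsub>sanov\<^esub> d) \<otimes>\<^bsub>sanov\<^esub> (c \<otimes>\<^bsub>sanov\<^esub> c)"
    by (rule bexI[of _ La], rule bexI[of _ Lb]) simp_all
qed

section \<open>A homomorphism to the integers with a large kernel\<close>

text \<open>
The pair \<open>(m, c)\<close> is the affine map \<open>t \<mapsto> 2\<^sup>m t + c\<close>. The
maps \<open>t \<mapsto> 2 t\<close> and \<open>t \<mapsto> t + 1\<close> generate the
Baumslag--Solitar group \<open>BS(1,2)\<close>, whose translations by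
\<open>2\<^sup>-\<^sup>n\<close> have unbounded denominators.
\<close>
definition dyadic_affine :: "(int \<times> rat) monoid" where
  "dyadic_affine = \<lparr>carrier = UNIV, monoid.mult = (\<lambda>(m, c) (n, d). (m + n, c + 2 powi m * d)),
     monoid.one = (0, 0)\<rparr>"

lemma dyadic_affine_simps [simp]:
  "carrier dyadic_affine = UNIV"
  "(m, c) \<otimes>\<^bsub>dyadic_affine\<^esub> (n, d) = (m + n, c + 2 powi m * d)"
  "\<one>\<^bsub>dyadic_affine\<^esub> = (0, 0)"
  by (simp_all add: dyadic_affine_def)

lemma group_dyadic_affine: "group dyadic_affine"
proof (rule groupI)
  show "x \<otimes>\<^bsub>dyadic_affine\<^esub> y \<otimes>\<^bsub>dyadic_affine\<^esub> z = x \<otimes>\<^bsub>dyadic_affine\<^esub> (y \<otimes>\<^bsub>dyadic_affine\<^esub> z)" for x y z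
    by (cases x; cases y; cases z) (simp add: power_int_add algebra_simps)
  show "\<one>\<^bsub>dyadic_affine\<^esub> \<otimes>\<^bsub>dyadic_affine\<^esub> x = x" for x by (cases x) simp
  show "\<exists>y\<in>carrier dyadic_affine. y \<otimes>\<^bsub>dyadic_affine\<^esub> x = \<one>\<^bsub>dyadic_affine\<^esub>" for x
  proof -
    obtain m c where "x = (m, c)" by (cases x)
    then show ?thesis by (intro bexI[of _ "(-m, - (2 powi (-m) * c))"]) simp_all
  qed
qed simp_all

lemma inv_dyadic_affine [simp]: "inv\<^bsub>dyadic_affine\<^esub> (m, c) = (-m, - (2 powi (-m) * c))"
  by (rule group.inv_equality[OF group_dyadic_affine]) simp_all

definition to_affine :: "int \<times> int \<times> int \<times> int \<Rightarrow> int \<times> rat" where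
  "to_affine = sanov.lift dyadic_affine
     (\<lambda>x. if x = La then (1, 0) else if x = La' then (-1, 0) else if x = Lb then (0, 1) else (0, -1))"

lemma to_affine_hom: "to_affine \<in> hom sanov dyadic_affine"
  unfolding to_affine_def
  by (rule sanov.lift_hom[OF group_dyadic_affine]) (auto simp: letters_def)

lemma to_affine_letters: "to_affine La = (1, 0)" "to_affine La' = (-1, 0)" "to_affine Lb = (0, 1)"
  unfolding to_affine_def
  by (subst sanov.lift_letter[OF group_dyadic_affine]; simp add: letters_def)+

lemma to_affine_mult:
  assumes "g \<in> carrier sanov" "h \<in> carrier sanov"
  shows "to_affine (g \<otimes>\<^bsub>sanov\<^esub> h) = to_affine g \<otimes>\<^bsub>dyadic_affine\<^esub> to_affine h"
  by (rule hom_mult[OF to_affine_hom assms])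

lemma to_affine_inv:
  assumes "g \<in> carrier sanov"
  shows "to_affine (inv\<^bsub>sanov\<^esub> g) = inv\<^bsub>dyadic_affine\<^esub> (to_affine g)"
  using assms to_affine_hom group_sanov group_dyadic_affine
  by (intro group_hom.hom_inv) (auto simp: group_hom_def group_hom_axioms_def)

definition exponent_sum :: "int \<times> int \<times> int \<times> int \<Rightarrow> int" where
  "exponent_sum g = fst (to_affine g)"

lemma exponent_sum_hom: "exponent_sum \<in> hom sanov integer_group"
proof (rule homI)
  show "exponent_sum (g \<otimes>\<^bsub>sanov\<^esub> h) = exponent_sum g \<otimes>\<^bsub>integer_group\<^esub> exponent_sum h"
    if "g \<in> carrier sanov" "h \<in> carrier sanov" for g h
    using that
    by (cases "to_affine g"; cases "to_affine h") (simp add: exponent_sum_def to_affine_mult)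
qed simp

lemma common_denominator:
  fixes S :: "rat set"
  assumes "finite S"
  shows "\<exists>N::int. N > 0 \<and> (\<forall>x\<in>S. of_int N * x \<in> \<int>)"
  using assms
proof (induction S rule: finite_induct)
  case empty
  then show ?case by (intro exI[of _ 1]) simp
next
  case (insert x S)
  then obtain N :: int where N: "N > 0" "\<forall>y\<in>S. of_int N * y \<in> \<int>" by blast
  obtain a b where ab: "x = of_int a / of_int b" "b > (0::int)"
    by (cases x) (auto simp: Fract_of_int_quotient)
  have "of_int (N * b) * y \<in> \<int>" if "y \<in> insert x S" for y
  proof (cases "y = x")
    case True
    have "of_int (N * b) * y = of_int (N * a)" using ab True by simp
    then show ?thesis by (metis Ints_of_int)
  next
    case False
    then have "of_int N * y \<in> \<int>" using N(2) that by simp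
    then have "of_int b * (of_int N * y) \<in> \<int>" by (rule Ints_mult[OF Ints_of_int])
    then show ?thesis by (simp add: ac_simps)
  qed
  then show ?case using N(1) ab(2) by (intro exI[of _ "N * b"]) simp
qed

text \<open>
The kernel acts by translations, and the translations of a finitely generated subgroup have a common
denominator. But the conjugates \<open>a\<^sup>-\<^sup>n b a\<^sup>n\<close> lie in the kernel and
act as translations by \<open>2\<^sup>-\<^sup>n\<close>.
\<close>
lemma kernel_exponent_sum_not_fg: "\<not> fg_subgroup sanov (kernel sanov integer_group exponent_sum)"
proof
  let ?K = "kernel sanov integer_group exponent_sum"
  assume "fg_subgroup sanov ?K"
  then obtain S where S: "finite S" "S \<subseteq> ?K" "generate sanov S = ?K"
    unfolding fg_subgroup_def by blast
  obtain N :: int where N: "N > 0" "\<And>g. g \<in> S \<Longrightarrow> of_int N * snd (to_affine g) \<in> \<int>"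
    using common_denominator[OF finite_imageI[OF S(1), of "\<lambda>g. snd (to_affine g)"]] by blast
  have S_ker: "g \<in> carrier sanov \<and> fst (to_affine g) = 0" if "g \<in> S" for g
    using S(2) that by (auto simp: kernel_def exponent_sum_def)
  have bounded: "g \<in> carrier sanov \<and> fst (to_affine g) = 0 \<and> of_int N * snd (to_affine g) \<in> \<int>"
    if "g \<in> generate sanov S" for g
    using that
  proof (induction rule: generate.induct)
    case one
    have "to_affine \<one>\<^bsub>sanov\<^esub> = (0, 0)"
      using hom_one[OF to_affine_hom group_sanov group_dyadic_affine] by simp
    then show ?case by simp
  next
    case (incl g)
    then show ?case using S_ker N(2) by blast
  next
    case (inv g)
    obtain c where c: "to_affine g = (0, c)"
      using S_ker[OF inv] by (cases "to_affine g") simp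
    have "to_affine (inv\<^bsub>sanov\<^esub> g) = (0, - c)"
      unfolding to_affine_inv[OF conjunct1[OF S_ker[OF inv]]] c by simp
    moreover have "of_int N * c \<in> \<int>" using N(2)[OF inv] c by simp
    ultimately show ?case using S_ker[OF inv] by simp
  next
    case (eng g h)
    obtain c d where cd: "to_affine g = (0, c)" "to_affine h = (0, d)"
      using eng.IH by (cases "to_affine g"; cases "to_affine h") simp
    have "to_affine (g \<otimes>\<^bsub>sanov\<^esub> h) = (0, c + d)"
      using eng.IH cd by (simp add: to_affine_mult del: sanov_simps)
    then show ?case using eng.IH cd by (simp add: distrib_left)
  qed
  define w where "w n = ((\<lambda>g. La' \<otimes>\<^bsub>sanov\<^esub> g \<otimes>\<^bsub>sanov\<^esub> La) ^^ n) Lb" for n :: nat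
  have letters_carrier: "La \<in> carrier sanov" "La' \<in> carrier sanov" "Lb \<in> carrier sanov" by simp_all
  have w: "w n \<in> carrier sanov \<and> to_affine (w n) = (0, (1/2) ^ n)" for n
  proof (induction n)
    case 0
    then show ?case using letters_carrier by (simp add: w_def to_affine_letters)
  next
    case (Suc n)
    have "w (Suc n) = La' \<otimes>\<^bsub>sanov\<^esub> w n \<otimes>\<^bsub>sanov\<^esub> La" by (simp only: w_def funpow.simps comp_apply)
    moreover have "La' \<otimes>\<^bsub>sanov\<^esub> w n \<otimes>\<^bsub>sanov\<^esub> La \<in> carrier sanov"
      using Suc letters_carrier by (intro sanov.m_closed) auto
    moreover have "to_affine (La' \<otimes>\<^bsub>sanov\<^esub> w n \<otimes>\<^bsub>sanov\<^esub> La)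
        = to_affine La' \<otimes>\<^bsub>dyadic_affine\<^esub> to_affine (w n) \<otimes>\<^bsub>dyadic_affine\<^esub> to_affine La"
      using Suc letters_carrier by (subst to_affine_mult; (intro sanov.m_closed)?) (auto simp: to_affine_mult simp del: sanov_simps)
    ultimately show ?case using Suc by (simp add: to_affine_letters power_int_minus)
  qed
  obtain n where n: "N < 2 ^ n" using less_exp[of "nat N"] by (metis N(1) nat_less_iff of_nat_numeral of_nat_power order_less_imp_le zless_nat_eq_int_zless)
  have "w n \<in> ?K" using w[of n] by (simp add: kernel_def exponent_sum_def del: sanov_simps)
  then have "of_int N * (1/2) ^ n \<in> (\<int> :: rat set)"
    using bounded[of "w n"] w[of n] S(3) by simp
  then obtain m :: int where "of_int N * (1/2) ^ n = (of_int m :: rat)" by (elim Ints_cases)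
  then have "(of_int N :: rat) = of_int (m * 2 ^ n)" by (simp add: field_simps)
  then have m: "N = m * 2 ^ n" by (simp only: of_int_eq_iff)
  then have "m > 0" using N(1) by (simp add: zero_less_mult_iff)
  then have "2 ^ n \<le> m * 2 ^ n" by simp
  then show False using m n by simp
qed

section \<open>The counterexample\<close>

theorem mainTheorem6:
  shows "\<exists>H :: nat monoid. group H \<and> FGFPa H \<and>
           fg_subgroup H (derived H (carrier H)) \<and>
           \<not> FGFPa (H \<times>\<times> integer_group)"
proof (rule exists_nat_copy)
  show "group (wreath2 sanov)" by (rule sanov.group_wreath2)
  show "FGFPa (wreath2 sanov)"
    by (rule thin_centralizer_group.FGFPa_wreath2[OF thin_centralizer_group_sanov])
      (rule sanov.Fix_finitely_generated)
  show "fg_subgroup (wreath2 sanov) (derived (wreath2 sanov) (carrier (wreath2 sanov)))"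
    by (rule sanov.fg_derived_wreath2[OF sanov.finite_A sanov.A_carrier sanov.generate_A])
  show "\<not> FGFPa (wreath2 sanov \<times>\<times> integer_group)"
    by (rule sanov.not_FGFPa_wreath2_times_integer[OF exponent_sum_hom kernel_exponent_sum_not_fg])
qed

end
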